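(* Let $N\ge1$, $n\ge1$ and $\kappa\ge0$. The set $\{h_\mu:\mu\in\widetilde{\mathcal{P}}_n^{(N)}\}$ is a basis for $\mathbb{H}_{2n}^{B}$.
   Context: Partitions and symmetric functions. A partition is a finite sequence $\lambda=(\lambda_1,\lambda_2,\ldots)$ of nonnegative integers with $\lambda_1\ge\lambda_2\ge\cdots\ge0$; partitions with the same nonzero components are identified (so $\lambda_i=0$ beyond the length). $|\lambda|=\sum_i\lambda_i$, $l(\lambda)$ is the number of nonzero components, $\mathcal{P}_n^{(N)}$ is the set of partitions with $|\lambda|=n$, $l(\lambda)\le N$, regarded as elements of $\mathbb{N}_0^N$, and $\widetilde{\mathcal{P}}_n^{(N)}=\{\lambda\in\mathcal{P}_n^{(N)}:\lambda_1=\lambda_2\}$. For $\alpha\in\mathbb{N}_0^N$: $x^\alpha=\prod_i x_i^{\alpha_i}$, $\alpha!=\prod_i\alpha_i!$, $(t)_\alpha=\prod_i(t)_{\alpha_i}$ with $(t)_k=\prod_{i=1}^k(t+i-1)$, and $\alpha^+$ is $\alpha$ sorted in nonincreasing order. $m_\lambda=\sum\{x^\alpha:\alpha^+=\lambda\}$, $e_1=\sum_{i=1}^N x_i$, $\widetilde m_\lambda=e_1^{\lambda_1-\lambda_2}m_{(\lambda_2,\lambda_2,\lambda_3,\ldots)}$. The set $\{\widetilde m_\lambda:\lambda\in\mathcal{P}_n^{(N)}\}$ is a basis of the homogeneous symmetric polynomials of degree $n$, and $B(\mu,\lambda)$ is defined by $m_\lambda=\sum_{\mu\in\mathcal{P}_n^{(N)}}B(\mu,\lambda)\widetilde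 m_\mu$. The relation $\mu\preceq\lambda$ means $|\mu|=|\lambda|$ and $\lambda_i\le\mu_i$ for all $i\ge2$. $1^N=(1,\ldots,1)\in\mathbb{R}^N$ and $x^2=(x_1^2,\ldots,x_N^2)$. For $\mu\in\mathcal{P}_n^{(N)}$, \[h_\mu(x)=2^{-n}\sum_{\lambda\in\mathcal{P}_n^{(N)},\ \mu\preceq\lambda}\frac{B(\mu,\lambda)}{\lambda!\,(\kappa+\frac12)_\lambda}\,\frac{m_\lambda(x^2)}{m_\lambda(1^N)}.\] Harmonic polynomials. $\sigma_i$ is the reflection $(x_1,\ldots,x_N)\mapsto(x_1,\ldots,-x_i,\ldots,x_N)$ on $\mathbb{R}^N$. For polynomials $f$, $\mathcal{D}_if(x)=\frac{\partial f}{\partial x_i}(x)+\kappa\frac{f(x)-f(x\sigma_i)}{x_i}$ and $\Delta_\kappa=\sum_{i=1}^N\mathcal{D}_i^2$. $\mathbb{H}_{2n}^B$ is the space of homogeneous polynomials $f$ of degree $2n$ on $\mathbb{R}^N$ with $\Delta_\kappa f=0$ that are even in each $x_i$ and invariant under all permutations of coordinates. *)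

theory Defs
  imports "HOL-Analysis.Finite_Function_Topology" "HOL-Combinatorics.Permutations"
begin

section \<open>Real polynomials\<close>

text \<open>
  A polynomial is a finitely supported map from exponents to real coefficients, an exponent is a
  finitely supported map from variable indices to \<^typ>\<open>nat\<close>. Addition and multiplication are those
  of \<^theory>\<open>HOL-Library.Poly_Mapping\<close>. The indices of the variables $x_1,\ldots,x_N$
  are \<open>{1..N}\<close>.
\<close>

type_synonym expo = "nat \<Rightarrow>\<^sub>0 nat"
type_synonym rpoly = "expo \<Rightarrow>\<^sub>0 real"

lemma lookup_scaleR:
  fixes p :: "'a \<Rightarrow>\<^sub>0 'b::real_vector"
  shows "Poly_Mapping.lookup (c *\<^sub>R p) k = c *\<^sub>R Poly_Mapping.lookup p k"
proof -
  have "finite {i. c *\<^sub>R Poly_Mapping.lookup p i \<noteq> 0}"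
    by (rule finite_subset[OF _ finite_lookup[of p]]) auto
  then show ?thesis
    by (simp add: scaleR_poly_mapping_def)
qed

lemma scaleR_eq_single_times:
  fixes p :: "'a::monoid_add \<Rightarrow>\<^sub>0 'b::real_algebra_1"
  shows "c *\<^sub>R p = Poly_Mapping.single 0 (c *\<^sub>R 1) * p"
  by (rule poly_mapping_eqI)
     (simp add: mult_map_scale_conv_mult[symmetric] lookup_scaleR Poly_Mapping.map.rep_eq when_def)

instance poly_mapping :: (comm_monoid_add, "{real_algebra_1, comm_ring_1}") real_algebra_1
proof
  fix a :: real and x y :: "'a \<Rightarrow>\<^sub>0 'b"
  show "a *\<^sub>R x * y = a *\<^sub>R (x * y)"
    by (simp add: scaleR_eq_single_times mult.assoc)
  show "x * a *\<^sub>R y = a *\<^sub>R (x * y)"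
    by (simp add: scaleR_eq_single_times mult.left_commute)
qed

definition var :: "nat \<Rightarrow> rpoly" where
  "var i = Poly_Mapping.single (Poly_Mapping.single i 1) 1"

text \<open>
  Substitution of \<open>a i\<close> for the \<open>i\<close>-th variable, where the \<open>a i\<close> lie in any commutative real
  algebra. For \<open>'a = real\<close> this is evaluation at a point.
\<close>

definition psubst :: "(nat \<Rightarrow> 'a) \<Rightarrow> rpoly \<Rightarrow> 'a::{real_algebra_1, comm_ring_1}" where
  "psubst a f = (\<Sum>\<alpha>\<in>Poly_Mapping.keys f. Poly_Mapping.lookup f \<alpha> *\<^sub>R
     (\<Prod>i\<in>Poly_Mapping.keys \<alpha>. a i ^ Poly_Mapping.lookup \<alpha> i))"

definition exponents :: "nat \<Rightarrow> expo set" where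
  "exponents N = {\<alpha>. Poly_Mapping.keys \<alpha> \<subseteq> {1..N}}"

definition weight :: "expo \<Rightarrow> nat" where
  "weight \<alpha> = (\<Sum>i\<in>Poly_Mapping.keys \<alpha>. Poly_Mapping.lookup \<alpha> i)"

definition homogeneous_polys :: "nat \<Rightarrow> nat \<Rightarrow> rpoly set" where
  "homogeneous_polys N d = {f. \<forall>\<alpha>\<in>Poly_Mapping.keys f. \<alpha> \<in> exponents N \<and> weight \<alpha> = d}"


section \<open>Partitions and symmetric polynomials\<close>

text \<open>
  The parts of \<open>\<nu>\<close> are \<open>lookup \<nu> 1 \<ge> lookup \<nu> 2 \<ge> \<dots>\<close>; the index 0 is not used.
\<close>

definition is_partition :: "expo \<Rightarrow> bool" where
  "is_partition \<nu> \<longleftrightarrow> Poly_Mapping.lookup \<nu> 0 = 0 \<and>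
     (\<forall>i\<ge>1. Poly_Mapping.lookup \<nu> (Suc i) \<le> Poly_Mapping.lookup \<nu> i)"

definition part_length :: "expo \<Rightarrow> nat" where
  "part_length \<nu> = card (Poly_Mapping.keys \<nu>)"

definition Parts :: "nat \<Rightarrow> nat \<Rightarrow> expo set" where
  "Parts N n = {\<nu>. is_partition \<nu> \<and> weight \<nu> = n \<and> part_length \<nu> \<le> N}"

definition Parts_tilde :: "nat \<Rightarrow> nat \<Rightarrow> expo set" where
  "Parts_tilde N n = {\<nu>\<in>Parts N n. Poly_Mapping.lookup \<nu> 1 = Poly_Mapping.lookup \<nu> 2}"

definition part_le :: "expo \<Rightarrow> expo \<Rightarrow> bool" (infix \<open>\<preceq>\<close> 50) where
  "\<mu> \<preceq> \<nu> \<longleftrightarrow> weight \<mu> = weight \<nu> \<and>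
     (\<forall>i\<ge>2. Poly_Mapping.lookup \<nu> i \<le> Poly_Mapping.lookup \<mu> i)"

definition expo_fact :: "nat \<Rightarrow> expo \<Rightarrow> real" where
  "expo_fact N \<alpha> = (\<Prod>i=1..N. fact (Poly_Mapping.lookup \<alpha> i))"

definition expo_pochhammer :: "nat \<Rightarrow> real \<Rightarrow> expo \<Rightarrow> real" where
  "expo_pochhammer N t \<alpha> = (\<Prod>i=1..N. pochhammer t (Poly_Mapping.lookup \<alpha> i))"

text \<open>
  \<open>sort_expo N \<alpha>\<close> is $\alpha^+$. The leading 0 is the entry at the unused index 0.
\<close>

definition sort_expo :: "nat \<Rightarrow> expo \<Rightarrow> expo" where
  "sort_expo N \<alpha> =
     Poly_Mapping.nth (0 # rev (sort (map (Poly_Mapping.lookup \<alpha>) [1..<Suc N])))"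

definition msym :: "nat \<Rightarrow> expo \<Rightarrow> rpoly" where
  "msym N \<nu> = (\<Sum>\<alpha> | \<alpha> \<in> exponents N \<and> sort_expo N \<alpha> = \<nu>. Poly_Mapping.single \<alpha> 1)"

definition e1 :: "nat \<Rightarrow> rpoly" where
  "e1 N = (\<Sum>i=1..N. var i)"

definition msym_tilde :: "nat \<Rightarrow> expo \<Rightarrow> rpoly" where
  "msym_tilde N \<nu> =
     e1 N ^ (Poly_Mapping.lookup \<nu> 1 - Poly_Mapping.lookup \<nu> 2) *
     msym N (Poly_Mapping.update 1 (Poly_Mapping.lookup \<nu> 2) \<nu>)"

text \<open>
  \<open>Bcoeff N \<mu> \<nu>\<close> is the coordinate of \<open>msym N \<nu>\<close> at \<open>msym_tilde N \<mu>\<close>, with respect to the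
  basis of all \<open>msym_tilde N \<rho>\<close>, \<open>\<rho> \<in> Parts N (weight \<nu>)\<close>. Requiring the coordinate function to
  vanish outside of the index set makes it unique.
\<close>

definition Bcoeff :: "nat \<Rightarrow> expo \<Rightarrow> expo \<Rightarrow> real" where
  "Bcoeff N \<mu> \<nu> =
     (THE c. (\<forall>\<rho>. \<rho> \<notin> Parts N (weight \<nu>) \<longrightarrow> c \<rho> = 0) \<and>
             msym N \<nu> = (\<Sum>\<rho>\<in>Parts N (weight \<nu>). c \<rho> *\<^sub>R msym_tilde N \<rho>)) \<mu>"

definition hpoly :: "nat \<Rightarrow> real \<Rightarrow> expo \<Rightarrow> rpoly" where
  "hpoly N \<kappa> \<mu> = (1 / 2 ^ weight \<mu>) *\<^sub>R
     (\<Sum>\<nu> | \<nu> \<in> Parts N (weight \<mu>) \<and> \<mu> \<preceq> \<nu>.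
        (Bcoeff N \<mu> \<nu> / (expo_fact N \<nu> * expo_pochhammer N (\<kappa> + 1 / 2) \<nu>)) *\<^sub>R
        ((1 / psubst (\<lambda>_. 1) (msym N \<nu>)) *\<^sub>R psubst (\<lambda>i. var i ^ 2) (msym N \<nu>)))"


section \<open>Harmonic polynomials\<close>

text \<open>
  In \<open>pderiv_var\<close> the truncated subtraction on exponents is harmless: the coefficient is 0
  whenever it truncates.
\<close>

definition pderiv_var :: "nat \<Rightarrow> rpoly \<Rightarrow> rpoly" where
  "pderiv_var i f = (\<Sum>\<alpha>\<in>Poly_Mapping.keys f.
     Poly_Mapping.single (\<alpha> - Poly_Mapping.single i 1)
       (of_nat (Poly_Mapping.lookup \<alpha> i) * Poly_Mapping.lookup f \<alpha>))"

definition reflect_var :: "nat \<Rightarrow> rpoly \<Rightarrow> rpoly" where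
  "reflect_var i f = psubst (\<lambda>j. if j = i then - var j else var j) f"

text \<open>
  The quotient of \<open>f - reflect_var i f\<close> by \<open>var i\<close> is taken in the polynomial ring, where it
  exists and is unique.
\<close>

definition reflect_quotient :: "nat \<Rightarrow> rpoly \<Rightarrow> rpoly" where
  "reflect_quotient i f = (THE g. var i * g = f - reflect_var i f)"

definition dunkl :: "real \<Rightarrow> nat \<Rightarrow> rpoly \<Rightarrow> rpoly" where
  "dunkl \<kappa> i f = pderiv_var i f + \<kappa> *\<^sub>R reflect_quotient i f"

definition dunkl_laplacian :: "nat \<Rightarrow> real \<Rightarrow> rpoly \<Rightarrow> rpoly" where
  "dunkl_laplacian N \<kappa> f = (\<Sum>i=1..N. dunkl \<kappa> i (dunkl \<kappa> i f))"

text \<open>$\mathbb{H}_{2n}^B$ is \<open>harmonic_B N \<kappa> (2 * n)\<close>.\<close>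

definition harmonic_B :: "nat \<Rightarrow> real \<Rightarrow> nat \<Rightarrow> rpoly set" where
  "harmonic_B N \<kappa> d = {f \<in> homogeneous_polys N d.
     dunkl_laplacian N \<kappa> f = 0 \<and>
     (\<forall>i\<in>{1..N}. reflect_var i f = f) \<and>
     (\<forall>\<pi>. \<pi> permutes {1..N} \<longrightarrow> psubst (\<lambda>i. var (\<pi> i)) f = f)}"

end

theory Submission
  imports Defs
begin

text \<open>
  Sending \<open>x\<^sup>\<alpha>\<close> to the coefficient of a polynomial \<open>f\<close> at \<open>x\<^bsup>2\<alpha>\<^esup>\<close>, times \<open>\<alpha>! (\<kappa> + 1/2)\<^sub>\<alpha>\<close>, makes
  \<open>f\<close> a functional on homogeneous polynomials of degree \<open>n\<close>. Under this pairing the adjoint of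
  \<open>\<Delta>\<^sub>\<kappa>\<close> is multiplication by \<open>4 e\<^sub>1\<close>, so the harmonic symmetric polynomials are the functionals
  on symmetric polynomials that annihilate the multiples of \<open>e\<^sub>1\<close>. These multiples are spanned by
  the modified monomial symmetric polynomials with \<open>\<lambda>\<^sub>1 > \<lambda>\<^sub>2\<close>, and up to the factor \<open>2\<^sup>n\<close> the
  \<open>h\<^sub>\<mu>\<close> are the dual basis: \<open>B(\<mu>, \<lambda>)\<close> vanishes unless \<open>\<mu> \<preceq> \<lambda>\<close>, since \<open>e\<^sub>1\<^sup>k m\<^sub>\<nu>\<close> only contains
  monomials whose exponent dominates a rearrangement of \<open>\<nu>\<close> componentwise.
\<close>

section \<open>Coefficients of substitutions and Dunkl operators\<close>

abbreviation (input) "lookup \<equiv> Poly_Mapping.lookup"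
abbreviation (input) "keys \<equiv> Poly_Mapping.keys"
abbreviation (input) "single \<equiv> Poly_Mapping.single"
abbreviation (input) "map_key \<equiv> Poly_Mapping.map_key"

lemma prod_single:
  fixes c :: "'a \<Rightarrow> real" and g :: "'a \<Rightarrow> expo"
  assumes "finite A"
  shows "(\<Prod>i\<in>A. single (g i) (c i)) = single (\<Sum>i\<in>A. g i) (\<Prod>i\<in>A. c i)"
  using assms by (induction A rule: finite_induct) (auto simp: mult_single)

lemma var_power: "var i ^ k = single (single i k) 1"
  by (induction k) (auto simp: var_def mult_single simp flip: single_add)

text \<open>Monomials go to scalar multiples of monomials, injectively in the exponent, so nothing
  cancels. This single fact serves sign changes, permutations of variables and squaring.\<close>

lemma lookup_psubst_monomial:
  fixes a :: "nat \<Rightarrow> rpoly"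
  assumes mono: "\<And>\<alpha>. (\<Prod>i\<in>keys \<alpha>. a i ^ lookup \<alpha> i) = single (\<phi> \<alpha>) (s \<alpha>)"
    and "inj \<phi>"
  shows "lookup (psubst a f) (\<phi> \<alpha>) = s \<alpha> * lookup f \<alpha>"
    and "\<gamma> \<notin> range \<phi> \<Longrightarrow> lookup (psubst a f) \<gamma> = 0"
proof -
  have eq: "lookup (psubst a f) \<gamma> =
      (\<Sum>\<alpha>\<in>keys f. if \<phi> \<alpha> = \<gamma> then s \<alpha> * lookup f \<alpha> else 0)" for \<gamma>
    unfolding psubst_def mono lookup_sum
    by (rule sum.cong) (auto simp: lookup_scaleR lookup_single when_def)
  show "\<gamma> \<notin> range \<phi> \<Longrightarrow> lookup (psubst a f) \<gamma> = 0"
    unfolding eq by (rule sum.neutral) auto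
  show "lookup (psubst a f) (\<phi> \<alpha>) = s \<alpha> * lookup f \<alpha>"
    unfolding eq using \<open>inj \<phi>\<close> by (auto simp: inj_eq in_keys_iff)
qed

lemma sum_single_lookup:
  "(\<Sum>i\<in>keys \<alpha>. single i (lookup \<alpha> i)) = (\<alpha>::'a \<Rightarrow>\<^sub>0 'b::comm_monoid_add)"
  by (rule poly_mapping_eqI) (auto simp: lookup_sum lookup_single when_def in_keys_iff)

lemma lookup_reflect_var:
  "lookup (reflect_var i f) \<alpha> = (-1) ^ lookup \<alpha> i * lookup f \<alpha>"
proof -
  have m: "(\<Prod>j\<in>keys \<alpha>. (if j = i then - var j else var j) ^ lookup \<alpha> j)
      = single \<alpha> ((-1) ^ lookup \<alpha> i)" for \<alpha>
  proof -
    have "(if j = i then - var j else var j) ^ k =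
      single (single j k) (if j = i then (-1) ^ k else 1)" for j k
      by (cases "even k") (auto simp: var_power single_uminus)
    then have "(\<Prod>j\<in>keys \<alpha>. (if j = i then - var j else var j) ^ lookup \<alpha> j)
      = single \<alpha> (\<Prod>j\<in>keys \<alpha>. if j = i then (-1) ^ lookup \<alpha> j else 1)"
      by (simp add: prod_single sum_single_lookup)
    also have "(\<Prod>j\<in>keys \<alpha>. if j = i then (-1) ^ lookup \<alpha> j else (1::real))
       = (-1) ^ lookup \<alpha> i"
      by (subst prod.delta) (auto simp: in_keys_iff)
    finally show ?thesis .
  qed
  show ?thesis
    unfolding reflect_var_def
    using lookup_psubst_monomial(1)[of _ "\<lambda>\<alpha>. \<alpha>", OF m] by simp
qed

lemma sum_single_perm:
  assumes "bij \<pi>"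
  shows "(\<Sum>i\<in>keys \<alpha>. single (\<pi> i) (lookup \<alpha> i)) =
    map_key (inv \<pi>) (\<alpha>::expo)"
proof (rule poly_mapping_eqI)
  fix k
  have "\<pi> i = k \<longleftrightarrow> i = inv \<pi> k" for i
    using assms by (metis bij_inv_eq_iff)
  then show "lookup (\<Sum>i\<in>keys \<alpha>. single (\<pi> i) (lookup \<alpha> i)) k =
    lookup (map_key (inv \<pi>) \<alpha>) k"
    using assms
    by (auto simp: lookup_sum lookup_single when_def map_key.rep_eq bij_is_inj[OF bij_imp_bij_inv] in_keys_iff)
qed

text \<open>The substitution moves the exponent \<open>\<beta>\<close> to
  \<open>map_key (inv \<pi>) \<beta>\<close>, so reading a coefficient back uses
  \<open>\<pi>\<close> itself.\<close>

lemma lookup_psubst_perm: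
  assumes "bij \<pi>"
  shows "lookup (psubst (\<lambda>i. var (\<pi> i)) f) \<alpha> = lookup f (map_key \<pi> \<alpha>)"
proof -
  have i: "inj \<pi>" "inj (inv \<pi>)"
    using assms by (simp_all add: bij_is_inj bij_imp_bij_inv)
  have c: "map_key \<pi> (map_key (inv \<pi>) \<beta>) = \<beta>"
     "map_key (inv \<pi>) (map_key \<pi> \<beta>) = \<beta>" for \<beta> :: expo
    using assms by (auto intro!: poly_mapping_eqI simp: map_key.rep_eq i bij_is_surj surj_f_inv_f inv_f_f)
  have "lookup (psubst (\<lambda>i. var (\<pi> i)) f) (map_key (inv \<pi>) \<beta>)
     = 1 * lookup f \<beta>" for \<beta>
    by (rule lookup_psubst_monomial(1))
       (auto simp: var_power prod_single sum_single_perm[OF assms] intro: inj_on_inverseI[of _ "map_key \<pi>"] c)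
  from this[of "map_key \<pi> \<alpha>"] show ?thesis by (simp add: c)
qed

lemma lookup_psubst_square:
  "lookup (psubst (\<lambda>i. var i ^ 2) f) (\<alpha> + \<alpha>) = lookup f \<alpha>"
  "\<nexists>\<alpha>. \<gamma> = \<alpha> + \<alpha> \<Longrightarrow> lookup (psubst (\<lambda>i. var i ^ 2) f) \<gamma> = 0"
proof -
  have m: "(\<Prod>i\<in>keys \<alpha>. (var i ^ 2) ^ lookup \<alpha> i) = single (\<alpha> + \<alpha>) 1" for \<alpha>
  proof -
    have "(var i ^ 2) ^ k = single (single i k + single i k) 1" for i k
      by (metis power_mult var_power mult_2 single_add)
    then show ?thesis
      by (simp add: prod_single sum.distrib sum_single_lookup)
  qed
  have i: "inj (\<lambda>\<alpha>::expo. \<alpha> + \<alpha>)"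
  proof (rule injI)
    fix a b :: expo
    assume "a + a = b + b"
    then have "lookup (a + a) k = lookup (b + b) k" for k
      by simp
    then have "lookup a k + lookup a k = lookup b k + lookup b k" for k
      by (metis lookup_add)
    then have "lookup a k = lookup b k" for k
      by (metis mult_2 mult_left_cancel zero_neq_numeral)
    then show "a = b"
      by (rule poly_mapping_eqI)
  qed
  show "lookup (psubst (\<lambda>i. var i ^ 2) f) (\<alpha> + \<alpha>) = lookup f \<alpha>"
    using lookup_psubst_monomial(1)[OF m i] by simp
  show "\<nexists>\<alpha>. \<gamma> = \<alpha> + \<alpha> \<Longrightarrow> lookup (psubst (\<lambda>i. var i ^ 2) f) \<gamma> = 0"
    using lookup_psubst_monomial(2)[OF m i, of \<gamma> f] by auto
qed

text \<open>Subtraction of exponents truncates, so the case where the monomial with exponent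
  \<open>k\<close> does not divide the one with exponent \<open>\<gamma>\<close> has to be split
  off.\<close>

lemma lookup_single_times:
  fixes p :: rpoly
  shows "lookup (single k c * p) \<gamma> =
    (if \<forall>i. lookup k i \<le> lookup \<gamma> i then c * lookup p (\<gamma> - k) else 0)"
proof -
  have "single k c * p = (\<Sum>\<alpha>\<in>keys p. single (k + \<alpha>) (c * lookup p \<alpha>))"
    by (subst sum_single_lookup[of p, symmetric]) (simp add: sum_distrib_left mult_single)
  then have "lookup (single k c * p) \<gamma> = (\<Sum>\<alpha>\<in>keys p. if k + \<alpha> = \<gamma> then c * lookup p \<alpha> else 0)"
    by (simp add: lookup_sum lookup_single when_def)
  also have "\<dots> = (\<Sum>\<alpha>\<in>keys p. if \<alpha> = \<gamma> - k then
      if \<forall>i. lookup k i \<le> lookup \<gamma> i then c * lookup p \<alpha> else 0 else 0)"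
  proof (rule sum.cong)
    fix \<alpha>
    have "k + \<alpha> = \<gamma> \<longleftrightarrow> \<alpha> = \<gamma> - k \<and> (\<forall>i. lookup k i \<le> lookup \<gamma> i)"
      by (auto simp: poly_mapping_eq_iff fun_eq_iff lookup_add lookup_minus)
         (metis le_add1 add_diff_cancel_left')+
    then show "(if k + \<alpha> = \<gamma> then c * lookup p \<alpha> else 0) =
      (if \<alpha> = \<gamma> - k then if \<forall>i. lookup k i \<le> lookup \<gamma> i then c * lookup p \<alpha> else 0 else 0)"
      by auto
  qed simp
  also have "\<dots> = (if \<forall>i. lookup k i \<le> lookup \<gamma> i then c * lookup p (\<gamma> - k) else 0)"
    by (subst sum.delta) (auto simp: in_keys_iff)
  finally show ?thesis .
qed

section \<open>Derivatives, reflection quotients and the Dunkl Laplacian on coefficients\<close>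

lemma lookup_var_times:
  "lookup (var i * p) \<gamma> = (if lookup \<gamma> i = 0 then 0 else lookup p (\<gamma> - single i 1))"
  unfolding var_def lookup_single_times by (auto simp: lookup_single when_def)

lemma diff_add_single: "lookup \<alpha> i \<noteq> 0 \<Longrightarrow> \<alpha> - single i 1 + single i 1 = (\<alpha> :: expo)"
  by (rule poly_mapping_eqI) (auto simp: lookup_add lookup_minus lookup_single when_def)

text \<open>Common shape of the derivative and of the reflection quotient: the factor
  \<open>s\<close> kills the terms whose exponent would be truncated, and on the others lowering the
  exponent is injective.\<close>

lemma lookup_sum_shift:
  fixes f :: rpoly
  assumes "\<And>\<alpha>. lookup \<alpha> i = 0 \<Longrightarrow> s \<alpha> = 0"
  shows "lookup (\<Sum>\<alpha>\<in>keys f. single (\<alpha> - single i 1) (s \<alpha> * lookup f \<alpha>)) \<beta> =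
    s (\<beta> + single i 1) * lookup f (\<beta> + single i 1)"
proof -
  have "lookup (\<Sum>\<alpha>\<in>keys f. single (\<alpha> - single i 1) (s \<alpha> * lookup f \<alpha>)) \<beta> =
    (\<Sum>\<alpha>\<in>keys f. if \<alpha> = \<beta> + single i 1 then s \<alpha> * lookup f \<alpha> else 0)"
    unfolding lookup_sum
  proof (rule sum.cong)
    fix \<alpha>
    have "\<alpha> - single i 1 = \<beta> \<longleftrightarrow> \<alpha> = \<beta> + single i 1" if "lookup \<alpha> i \<noteq> 0"
      using diff_add_single[OF that] by auto
    then show "lookup (single (\<alpha> - single i 1) (s \<alpha> * lookup f \<alpha>)) \<beta> =
      (if \<alpha> = \<beta> + single i 1 then s \<alpha> * lookup f \<alpha> else 0)"
      using assms[of \<alpha>] by (auto simp: lookup_single when_def lookup_add)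
  qed simp
  then show ?thesis
    by (simp add: in_keys_iff)
qed

lemma lookup_pderiv_var:
  "lookup (pderiv_var i f) \<beta> = of_nat (lookup \<beta> i + 1) * lookup f (\<beta> + single i 1)"
  unfolding pderiv_var_def by (subst lookup_sum_shift) (auto simp: lookup_add)

text \<open>In \<open>f - reflect_var i f\<close> the terms even in the variable cancel and the odd
  ones double; dividing by the variable swaps the parities, hence the plus sign.\<close>

lemma lookup_reflect_quotient:
  "lookup (reflect_quotient i f) \<beta> = (1 + (-1) ^ lookup \<beta> i) * lookup f (\<beta> + single i 1)"
proof -
  \<comment> \<open>The explicit quotient: each term of the difference with its exponent at
    \<open>i\<close> lowered by one. Terms with exponent 0 at \<open>i\<close> carry the factor
    0.\<close>
  define g :: rpoly where
    "g = (\<Sum>\<alpha>\<in>keys f. single (\<alpha> - single i 1) ((1 - (-1) ^ lookup \<alpha> i) * lookup f \<alpha>))"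
  have g: "lookup g \<beta> = (1 + (-1) ^ lookup \<beta> i) * lookup f (\<beta> + single i 1)" for \<beta>
    unfolding g_def by (subst lookup_sum_shift) (auto simp: lookup_add)
  have "var i * g = f - reflect_var i f"
  proof (rule poly_mapping_eqI)
    fix \<gamma>
    show "lookup (var i * g) \<gamma> = lookup (f - reflect_var i f) \<gamma>"
    proof (cases "lookup \<gamma> i")
      case (Suc k)
      then show ?thesis
        using diff_add_single[of \<gamma> i]
        by (simp add: lookup_var_times g lookup_minus lookup_reflect_var distrib_right add.commute)
    qed (simp add: lookup_var_times lookup_minus lookup_reflect_var)
  qed
  note quot = this
  \<comment> \<open>Multiplication by a variable only shifts coefficients, so it can be cancelled;
    this makes the definite description in \<open>reflect_quotient\<close> well defined.\<close>
  have uniq: "h = g" if "var i * h = var i * g" for h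
  proof (rule poly_mapping_eqI)
    fix \<beta>
    have "lookup (var i * h) (\<beta> + single i 1) = lookup (var i * g) (\<beta> + single i 1)"
      by (simp only: that)
    then show "lookup h \<beta> = lookup g \<beta>"
      by (simp add: lookup_var_times lookup_add)
  qed
  have "reflect_quotient i f = g"
    unfolding reflect_quotient_def
  proof (rule the_equality)
    show "h = g" if "var i * h = f - reflect_var i f" for h
      using uniq[of h] by (simp only: quot that)
  qed (rule quot)
  then show ?thesis
    using g by simp
qed

lemma lookup_dunkl:
  "lookup (dunkl \<kappa> i f) \<beta> =
    (of_nat (lookup \<beta> i + 1) + \<kappa> * (1 + (-1) ^ lookup \<beta> i)) * lookup f (\<beta> + single i 1)"
  unfolding dunkl_def
  by (simp add: lookup_add lookup_scaleR lookup_pderiv_var lookup_reflect_quotient algebra_simps)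

text \<open>The inner Dunkl operator is read at an exponent raised by one at \<open>i\<close>, which
  flips the parity and so the sign in the second factor.\<close>

lemma lookup_dunkl_laplacian:
  "lookup (dunkl_laplacian N \<kappa> f) \<beta> = (\<Sum>i=1..N.
    (of_nat (lookup \<beta> i + 1) + \<kappa> * (1 + (-1) ^ lookup \<beta> i)) *
    (of_nat (lookup \<beta> i + 2) + \<kappa> * (1 - (-1) ^ lookup \<beta> i)) *
    lookup f (\<beta> + (single i 1 + single i 1)))"
  unfolding dunkl_laplacian_def lookup_sum
  by (rule sum.cong) (auto simp: lookup_dunkl lookup_add add.assoc algebra_simps)


section \<open>Rearrangements of exponents\<close>

lemma lookup_map_key: "inj \<pi> \<Longrightarrow> lookup (map_key \<pi> \<alpha>) k = lookup \<alpha> (\<pi> k)"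
  by (simp add: map_key.rep_eq)

lemmas lookup_map_key_perm = lookup_map_key[OF permutes_inj]

lemma map_key_minus_perm:
  "\<pi> permutes S \<Longrightarrow> map_key \<pi> (\<alpha> - \<beta>) = map_key \<pi> \<alpha> - map_key \<pi> (\<beta> :: expo)"
  by (rule poly_mapping_eqI) (simp add: lookup_map_key_perm lookup_minus)

lemma map_key_single_perm:
  "\<pi> permutes S \<Longrightarrow> map_key \<pi> (single (\<pi> i) c) = single i c"
  by (rule map_key_single[OF permutes_inj])

lemma in_exponents_iff: "\<alpha> \<in> exponents N \<longleftrightarrow> (\<forall>i. i \<notin> {1..N} \<longrightarrow> lookup \<alpha> i = 0)"
  unfolding exponents_def by (auto simp: in_keys_iff)

lemma weight_exponents: "\<alpha> \<in> exponents N \<Longrightarrow> weight \<alpha> = (\<Sum>i=1..N. lookup \<alpha> i)"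
  unfolding exponents_def weight_def by (rule sum.mono_neutral_left) (auto simp: in_keys_iff)

lemma map_key_exponents:
  assumes "\<pi> permutes {1..N}" "\<alpha> \<in> exponents N"
  shows "map_key \<pi> \<alpha> \<in> exponents N"
  using assms permutes_not_in[OF assms(1)] by (auto simp: in_exponents_iff lookup_map_key_perm)

lemma map_key_inv_perm:
  assumes "\<pi> permutes S"
  shows "map_key (inv \<pi>) (map_key \<pi> \<alpha>) = (\<alpha>::expo)"
  using assms permutes_inverses[OF assms] by (intro poly_mapping_eqI)
    (simp add: lookup_map_key_perm lookup_map_key_perm[OF permutes_inv[OF assms]])

lemma sum_map_key_perm:
  assumes "\<pi> permutes S"
  shows "(\<Sum>i\<in>S. g (lookup (map_key \<pi> \<alpha>) i)) = (\<Sum>i\<in>S. g (lookup \<alpha> i))"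
  using sum.permute[OF assms, of "\<lambda>i. g (lookup \<alpha> i)"] assms by (simp add: lookup_map_key_perm comp_def)

lemma prod_map_key_perm:
  assumes "\<pi> permutes S"
  shows "(\<Prod>i\<in>S. g (lookup (map_key \<pi> \<alpha>) i)) = (\<Prod>i\<in>S. g (lookup \<alpha> i))"
  using prod.permute[OF assms, of "\<lambda>i. g (lookup \<alpha> i)"] assms by (simp add: lookup_map_key_perm comp_def)

lemma weight_map_key:
  assumes "\<pi> permutes {1..N}" "\<alpha> \<in> exponents N"
  shows "weight (map_key \<pi> \<alpha>) = weight \<alpha>"
  unfolding weight_exponents[OF assms(2)] weight_exponents[OF map_key_exponents[OF assms]]
  using sum_map_key_perm[OF assms(1)] .

section \<open>Exponents and partitions of fixed weight\<close>

definition Exps :: "nat \<Rightarrow> nat \<Rightarrow> expo set" where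
  "Exps N n = {\<alpha> \<in> exponents N. weight \<alpha> = n}"

lemma finite_Exps [simp]: "finite (Exps N n)"
proof (rule finite_imageD)
  have "lookup \<alpha> i \<le> n" if "\<alpha> \<in> Exps N n" "i \<in> {1..N}" for \<alpha> i
    using that member_le_sum[of i "{1..N}" "lookup \<alpha>"]
    by (auto simp: Exps_def weight_exponents)
  then have "(\<lambda>\<alpha>. restrict (lookup \<alpha>) {1..N}) ` Exps N n \<subseteq> (\<Pi>\<^sub>E i\<in>{1..N}. {..n})"
    by (auto simp: PiE_iff)
  then show "finite ((\<lambda>\<alpha>. restrict (lookup \<alpha>) {1..N}) ` Exps N n)"
    by (rule finite_subset) (auto intro: finite_PiE)
  show "inj_on (\<lambda>\<alpha>. restrict (lookup \<alpha>) {1..N}) (Exps N n)"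
  proof (rule inj_onI, rule poly_mapping_eqI)
    fix \<alpha> \<beta> k
    assume *: "\<alpha> \<in> Exps N n" "\<beta> \<in> Exps N n"
      and eq: "restrict (lookup \<alpha>) {1..N} = restrict (lookup \<beta>) {1..N}"
    from eq have "restrict (lookup \<alpha>) {1..N} k = restrict (lookup \<beta>) {1..N} k"
      by (rule fun_cong)
    with * show "lookup \<alpha> k = lookup \<beta> k"
      by (cases "k \<in> {1..N}") (simp_all add: Exps_def in_exponents_iff)
  qed
qed

lemma map_key_Exps: "\<pi> permutes {1..N} \<Longrightarrow> \<alpha> \<in> Exps N n \<Longrightarrow> map_key \<pi> \<alpha> \<in> Exps N n"
  by (auto simp: Exps_def map_key_exponents weight_map_key)

lemma partition_antimono:
  assumes "is_partition \<nu>" "1 \<le> i" "i \<le> j"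
  shows "lookup \<nu> j \<le> lookup \<nu> i"
  using assms(3,2)
proof (induction j rule: dec_induct)
  case (step k)
  then show ?case
    using assms(1) unfolding is_partition_def by (meson le_trans)
qed simp

text \<open>A partition has no gaps: a nonzero part at \<open>k\<close> forces nonzero parts at
  \<open>1\<close> to \<open>k\<close>. Hence having at most \<open>N\<close> nonzero parts is the
  same as having support in \<open>{1..N}\<close>.\<close>

lemma Parts_eq: "Parts N n = {\<nu> \<in> Exps N n. is_partition \<nu>}"
proof -
  have "part_length \<nu> \<le> N \<longleftrightarrow> \<nu> \<in> exponents N" if \<nu>: "is_partition \<nu>" for \<nu>
  proof
    assume "\<nu> \<in> exponents N"
    then show "part_length \<nu> \<le> N"
      using card_mono[of "{1..N}" "keys \<nu>"] by (simp add: exponents_def part_length_def)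
  next
    assume le: "part_length \<nu> \<le> N"
    have "k \<in> {1..N}" if k: "lookup \<nu> k \<noteq> 0" for k
    proof -
      have "k \<ge> 1"
        using k \<nu> unfolding is_partition_def by (cases k) auto
      have "{1..k} \<subseteq> keys \<nu>"
        using partition_antimono[OF \<nu>, of _ k] k by (force simp: in_keys_iff)
      from card_mono[OF _ this] \<open>k \<ge> 1\<close> le show ?thesis
        by (simp add: part_length_def)
    qed
    then show "\<nu> \<in> exponents N"
      by (auto simp: in_exponents_iff)
  qed
  then show ?thesis
    unfolding Parts_def Exps_def by auto
qed

lemma finite_Parts [simp]: "finite (Parts N n)"
  by (simp add: Parts_eq)

section \<open>Sorting of exponents\<close>

lemma lookup_sort_expo:
  "lookup (sort_expo N \<alpha>) k =
    (if k \<in> {1..N} then rev (sort (map (lookup \<alpha>) [1..<Suc N])) ! (k - 1) else 0)"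
  unfolding sort_expo_def by (cases k) (auto simp: nth_default_def)

lemma sort_expo_exponents: "sort_expo N \<alpha> \<in> exponents N"
  by (auto simp: in_exponents_iff lookup_sort_expo)

lemma sort_expo_partition: "is_partition (sort_expo N \<alpha>)"
  unfolding is_partition_def
proof (intro conjI allI impI)
  fix i :: nat
  let ?L = "rev (sort (map (lookup \<alpha>) [1..<Suc N]))"
  assume "1 \<le> i"
  have "sorted_wrt (\<ge>) ?L"
    by (simp add: sorted_wrt_rev del: upt_Suc)
  then have "?L ! i \<le> ?L ! (i - 1)" if "i < N"
    using that \<open>1 \<le> i\<close> by (auto simp: sorted_wrt_iff_nth_less simp del: upt_Suc)
  then show "lookup (sort_expo N \<alpha>) (Suc i) \<le> lookup (sort_expo N \<alpha>) i"
    using \<open>1 \<le> i\<close> by (auto simp: lookup_sort_expo simp del: upt_Suc)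
qed (simp add: lookup_sort_expo)

lemma map_lookup_sort_expo:
  "map (lookup (sort_expo N \<alpha>)) [1..<Suc N] = rev (sort (map (lookup \<alpha>) [1..<Suc N]))"
  by (rule nth_equalityI) (auto simp: lookup_sort_expo simp del: upt_Suc)

text \<open>Sorting preserves the multiset of entries, and two families with the same multiset of
  values differ by a permutation of the indices.\<close>

lemma sort_expo_perm:
  assumes "\<alpha> \<in> exponents N"
  obtains \<pi> where "\<pi> permutes {1..N}" "sort_expo N \<alpha> = map_key \<pi> \<alpha>"
proof -
  have "mset (map (lookup (sort_expo N \<alpha>)) [1..<Suc N]) = mset (map (lookup \<alpha>) [1..<Suc N])"
    unfolding map_lookup_sort_expo by (simp del: upt_Suc)
  then have "image_mset (lookup (sort_expo N \<alpha>)) (mset_set {1..N}) = image_mset (lookup \<alpha>) (mset_set {1..N})"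
    by (simp add: atLeastLessThanSuc_atLeastAtMost del: upt_Suc)
  then obtain \<pi> where \<pi>: "\<pi> permutes {1..N}" "\<forall>x\<in>{1..N}. lookup (sort_expo N \<alpha>) x = lookup \<alpha> (\<pi> x)"
    using image_mset_eq_implies_permutes[of "{1..N}"] by blast
  have "sort_expo N \<alpha> = map_key \<pi> \<alpha>"
  proof (rule poly_mapping_eqI)
    fix k
    show "lookup (sort_expo N \<alpha>) k = lookup (map_key \<pi> \<alpha>) k"
      using \<pi> assms sort_expo_exponents[of N \<alpha>] permutes_not_in[OF \<pi>(1), of k]
      by (cases "k \<in> {1..N}") (auto simp: lookup_map_key_perm in_exponents_iff)
  qed
  with \<pi> that show thesis by blast
qed

lemma sort_expo_map_key:
  assumes "\<pi> permutes {1..N}"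
  shows "sort_expo N (map_key \<pi> \<alpha>) = sort_expo N \<alpha>"
proof -
  have "image_mset \<pi> (mset_set {1..N}) = mset_set {1..N}"
    using assms by (simp add: image_mset_mset_set permutes_inj_on permutes_image)
  moreover have "image_mset (lookup (map_key \<pi> \<alpha>)) (mset_set {1..N}) =
      image_mset (lookup \<alpha>) (image_mset \<pi> (mset_set {1..N}))"
    by (auto simp: lookup_map_key_perm[OF assms] multiset.map_comp intro!: image_mset_cong)
  ultimately have "mset (map (lookup (map_key \<pi> \<alpha>)) [1..<Suc N]) = mset (map (lookup \<alpha>) [1..<Suc N])"
    by (simp add: atLeastLessThanSuc_atLeastAtMost del: upt_Suc)
  then have "sort (map (lookup (map_key \<pi> \<alpha>)) [1..<Suc N]) = sort (map (lookup \<alpha>) [1..<Suc N])"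
    by (metis sorted_list_of_multiset_mset)
  then show ?thesis
    unfolding sort_expo_def by simp
qed

lemma sort_expo_partition_id:
  assumes "\<nu> \<in> exponents N" "is_partition \<nu>"
  shows "sort_expo N \<nu> = \<nu>"
proof -
  let ?L = "map (lookup \<nu>) [1..<Suc N]"
  have "sorted_wrt (\<ge>) ?L"
    unfolding sorted_wrt_iff_nth_less
    using partition_antimono[OF assms(2)] by (auto simp del: upt_Suc)
  then have "sorted (rev ?L)"
    by (simp add: sorted_wrt_rev del: upt_Suc)
  then have "sort (rev ?L) = rev ?L"
    by (rule sorted_sort_id)
  then have "sort ?L = rev ?L"
    by (metis sorted_list_of_multiset_mset mset_rev)
  then have "map (lookup (sort_expo N \<nu>)) [1..<Suc N] = ?L"
    unfolding map_lookup_sort_expo by (simp del: upt_Suc)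
  then have "lookup (sort_expo N \<nu>) k = lookup \<nu> k" if "k \<in> {1..N}" for k
    using that by (auto simp del: upt_Suc)
  then show ?thesis
    using assms(1) sort_expo_exponents[of N \<nu>]
    by (intro poly_mapping_eqI) (metis in_exponents_iff)
qed

lemma sort_expo_Parts: "\<alpha> \<in> Exps N n \<Longrightarrow> sort_expo N \<alpha> \<in> Parts N n"
  by (metis Exps_def mem_Collect_eq sort_expo_perm map_key_Exps Parts_eq sort_expo_partition)

text \<open>Pigeonhole: if the claim failed at \<open>i\<close>, the \<open>i\<close> largest
  entries of \<open>\<alpha>\<close> would sit at positions where \<open>\<gamma>\<close> exceeds
  its \<open>i\<close>-th largest entry, but there are at most \<open>i - 1\<close> such
  positions.\<close>

lemma sort_expo_mono:
  assumes "\<alpha> \<in> exponents N" "\<gamma> \<in> exponents N" "\<And>i. lookup \<alpha> i \<le> lookup \<gamma> i"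
  shows "lookup (sort_expo N \<alpha>) i \<le> lookup (sort_expo N \<gamma>) i"
proof (rule ccontr)
  assume "\<not> ?thesis"
  then have less: "lookup (sort_expo N \<gamma>) i < lookup (sort_expo N \<alpha>) i"
    by simp
  then have i: "i \<in> {1..N}"
    by (metis in_exponents_iff sort_expo_exponents not_less_zero)
  obtain \<pi> where \<pi>: "\<pi> permutes {1..N}" "sort_expo N \<alpha> = map_key \<pi> \<alpha>"
    using sort_expo_perm[OF assms(1)] .
  obtain \<pi>' where \<pi>': "\<pi>' permutes {1..N}" "sort_expo N \<gamma> = map_key \<pi>' \<gamma>"
    using sort_expo_perm[OF assms(2)] .
  \<comment> \<open>\<open>\<tau> j\<close> is the rank within \<open>\<gamma>\<close> of the
    position that carries the \<open>j\<close>-th part of the sorted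
    \<open>\<alpha>\<close>.\<close>
  define \<tau> where "\<tau> = inv \<pi>' \<circ> \<pi>"
  have \<tau>: "\<tau> permutes {1..N}"
    unfolding \<tau>_def using \<pi> \<pi>' by (simp add: permutes_compose permutes_inv)
  have "\<tau> j \<in> {1..<i}" if "j \<in> {1..i}" for j
  proof -
    have "lookup (sort_expo N \<alpha>) i \<le> lookup (sort_expo N \<alpha>) j"
      using that by (intro partition_antimono sort_expo_partition) auto
    also have "\<dots> \<le> lookup \<gamma> (\<pi> j)"
      using \<pi> assms(3) by (simp add: lookup_map_key_perm)
    also have "\<dots> = lookup (sort_expo N \<gamma>) (\<tau> j)"
      using \<pi>' by (simp add: lookup_map_key_perm \<tau>_def permutes_inverses)
    finally have "lookup (sort_expo N \<gamma>) i < lookup (sort_expo N \<gamma>) (\<tau> j)"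
      using less by simp
    moreover have "\<tau> j \<in> {1..N}"
      using permutes_in_image[OF \<tau>, of j] that i by auto
    ultimately show ?thesis
      using partition_antimono[OF sort_expo_partition, of i "\<tau> j" N \<gamma>] i by force
  qed
  then have "card (\<tau> ` {1..i}) \<le> card {1..<i}"
    by (intro card_mono) auto
  moreover have "card (\<tau> ` {1..i}) = i"
    using card_image[OF permutes_inj_on[OF \<tau>]] by simp
  ultimately show False
    using i by auto
qed

section \<open>The basis of modified monomial symmetric polynomials\<close>

text \<open>Symmetry is phrased on coefficients, since the arguments below compare coefficients;
  \<open>psubst_perm_eq_iff\<close> shows that this agrees with invariance under
  substitution.\<close>

definition sym_polys :: "nat \<Rightarrow> nat \<Rightarrow> rpoly set" where
  "sym_polys N n = {p \<in> homogeneous_polys N n.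
     \<forall>\<pi>. \<pi> permutes {1..N} \<longrightarrow> (\<forall>\<alpha>. lookup p (map_key \<pi> \<alpha>) = lookup p \<alpha>)}"

text \<open>The support of \<open>msym N \<nu>\<close>; for a partition \<open>\<nu>\<close> with at
  most \<open>N\<close> parts it is the orbit of \<open>\<nu>\<close> under permutations of
  \<open>{1..N}\<close>.\<close>

definition orbit_expo :: "nat \<Rightarrow> expo \<Rightarrow> expo set" where
  "orbit_expo N \<nu> = {\<alpha> \<in> exponents N. sort_expo N \<alpha> = \<nu>}"

lemma sort_expo_weight: "\<alpha> \<in> exponents N \<Longrightarrow> weight (sort_expo N \<alpha>) = weight \<alpha>"
  by (metis sort_expo_perm weight_map_key)

lemma orbit_expo_subset: "orbit_expo N \<nu> \<subseteq> Exps N (weight \<nu>)"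
  by (auto simp: orbit_expo_def Exps_def sort_expo_weight)

lemma finite_orbit_expo [simp]: "finite (orbit_expo N \<nu>)"
  using orbit_expo_subset finite_Exps by (rule finite_subset)

lemma orbit_expo_self: "\<nu> \<in> Parts N n \<Longrightarrow> \<nu> \<in> orbit_expo N \<nu>"
  by (auto simp: orbit_expo_def Parts_eq Exps_def sort_expo_partition_id)

lemma orbit_expo_Parts_subset: "\<nu> \<in> Parts N n \<Longrightarrow> orbit_expo N \<nu> \<subseteq> Exps N n"
  using orbit_expo_subset[of N \<nu>] by (auto simp: Parts_def)

lemma lookup_msym: "lookup (msym N \<nu>) \<alpha> = (if \<alpha> \<in> orbit_expo N \<nu> then 1 else 0)"
  unfolding msym_def lookup_sum orbit_expo_def[symmetric] by (simp add: lookup_single when_def)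

lemma sym_lookup_sort_expo:
  assumes "p \<in> sym_polys N n" "\<alpha> \<in> exponents N"
  shows "lookup p (sort_expo N \<alpha>) = lookup p \<alpha>"
proof -
  obtain \<pi> where "\<pi> permutes {1..N}" "sort_expo N \<alpha> = map_key \<pi> \<alpha>"
    using sort_expo_perm[OF assms(2)] .
  with assms(1) show ?thesis
    by (simp add: sym_polys_def)
qed

lemma homogeneous_polys_iff:
  "p \<in> homogeneous_polys N n \<longleftrightarrow> (\<forall>\<alpha>. lookup p \<alpha> \<noteq> 0 \<longrightarrow> \<alpha> \<in> Exps N n)"
  by (auto simp: homogeneous_polys_def Exps_def in_keys_iff)

text \<open>An exponent lies in exactly one orbit, that of its sorted form, so a single summand
  contributes to each coefficient.\<close>

lemma sym_expansion:
  assumes p: "p \<in> sym_polys N n"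
  shows "p = (\<Sum>\<nu>\<in>Parts N n. lookup p \<nu> *\<^sub>R msym N \<nu>)"
proof (rule poly_mapping_eqI)
  fix \<gamma>
  have hom: "p \<in> homogeneous_polys N n"
    using p by (simp add: sym_polys_def)
  have eq: "lookup (\<Sum>\<nu>\<in>Parts N n. lookup p \<nu> *\<^sub>R msym N \<nu>) \<gamma> =
      (\<Sum>\<nu>\<in>Parts N n. if \<gamma> \<in> orbit_expo N \<nu> then lookup p \<nu> else 0)"
    by (auto simp: lookup_sum lookup_scaleR lookup_msym intro!: sum.cong)
  show "lookup p \<gamma> = lookup (\<Sum>\<nu>\<in>Parts N n. lookup p \<nu> *\<^sub>R msym N \<nu>) \<gamma>"
  proof (cases "\<gamma> \<in> Exps N n")
    case True
    then have "\<gamma> \<in> orbit_expo N \<nu> \<longleftrightarrow> \<nu> = sort_expo N \<gamma>" for \<nu>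
      by (auto simp: orbit_expo_def Exps_def)
    then show ?thesis
      using True sort_expo_Parts[OF True] sym_lookup_sort_expo[OF p, of \<gamma>]
      unfolding eq by (simp add: Exps_def)
  next
    case False
    then show ?thesis
      using hom orbit_expo_Parts_subset[of _ N n]
      unfolding eq homogeneous_polys_iff by (subst sum.neutral) auto
  qed
qed

lemma orbit_expo_map_key:
  assumes "\<pi> permutes {1..N}"
  shows "map_key \<pi> \<alpha> \<in> orbit_expo N \<nu> \<longleftrightarrow> \<alpha> \<in> orbit_expo N \<nu>"
  using map_key_exponents[OF assms, of \<alpha>]
    map_key_exponents[OF permutes_inv[OF assms], of "map_key \<pi> \<alpha>"]
  by (auto simp: orbit_expo_def sort_expo_map_key[OF assms] map_key_inv_perm[OF assms])

lemma msym_in_sym_polys: "\<nu> \<in> Parts N n \<Longrightarrow> msym N \<nu> \<in> sym_polys N n"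
  using orbit_expo_Parts_subset[of \<nu> N n]
  unfolding sym_polys_def homogeneous_polys_iff by (auto simp: lookup_msym orbit_expo_map_key)

section \<open>Multiplication by powers of \<open>e1\<close>\<close>

lemma lookup_e1_times:
  "lookup (e1 N * p) \<gamma> = (\<Sum>i=1..N. if lookup \<gamma> i = 0 then 0 else lookup p (\<gamma> - single i 1))"
  unfolding e1_def sum_distrib_right lookup_sum lookup_var_times ..

lemma weight_add_single:
  assumes "\<alpha> \<in> exponents N" "i \<in> {1..N}"
  shows "\<alpha> + single i k \<in> exponents N" "weight (\<alpha> + single i k) = weight \<alpha> + k"
proof -
  show *: "\<alpha> + single i k \<in> exponents N"
    using assms by (auto simp: in_exponents_iff lookup_add lookup_single when_def)
  show "weight (\<alpha> + single i k) = weight \<alpha> + k"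
    using assms(2)
    by (simp add: weight_exponents[OF *] weight_exponents[OF assms(1)] lookup_add lookup_single
        when_def sum.distrib)
qed

lemma Exps_add_single:
  assumes "\<alpha> \<in> Exps N n" "i \<in> {1..N}"
  shows "\<alpha> + single i k \<in> Exps N (n + k)"
  using assms weight_add_single[of \<alpha> N i k] by (auto simp: Exps_def)

lemma sym_e1_times:
  assumes "p \<in> sym_polys N n"
  shows "e1 N * p \<in> sym_polys N (Suc n)"
  unfolding sym_polys_def homogeneous_polys_iff
proof (intro CollectI conjI allI impI)
  fix \<gamma>
  assume "lookup (e1 N * p) \<gamma> \<noteq> 0"
  then obtain i where "i \<in> {1..N}" "(if lookup \<gamma> i = 0 then 0 else lookup p (\<gamma> - single i 1)) \<noteq> 0"
    unfolding lookup_e1_times by (rule sum.not_neutral_contains_not_neutral)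
  then have i: "i \<in> {1..N}" "lookup \<gamma> i \<noteq> 0" "lookup p (\<gamma> - single i 1) \<noteq> 0"
    by (auto split: if_splits)
  then have "\<gamma> - single i 1 \<in> Exps N n"
    using assms by (auto simp: sym_polys_def homogeneous_polys_iff)
  from Exps_add_single[OF this i(1), of 1] show "\<gamma> \<in> Exps N (Suc n)"
    using diff_add_single[OF i(2)] by simp
next
  fix \<pi> \<alpha>
  assume \<pi>: "\<pi> permutes {1..N}"
  have shift: "lookup p (map_key \<pi> \<alpha> - single i 1) = lookup p (\<alpha> - single (\<pi> i) 1)" for i
  proof -
    have "map_key \<pi> \<alpha> - single i 1 = map_key \<pi> (\<alpha> - single (\<pi> i) 1)"
      by (simp only: map_key_minus_perm[OF \<pi>] map_key_single_perm[OF \<pi>])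
    then show ?thesis
      using assms \<pi> by (auto simp: sym_polys_def)
  qed
  have "lookup (e1 N * p) (map_key \<pi> \<alpha>) =
     (\<Sum>i=1..N. if lookup \<alpha> (\<pi> i) = 0 then 0 else lookup p (\<alpha> - single (\<pi> i) 1))"
    unfolding lookup_e1_times lookup_map_key_perm[OF \<pi>] shift ..
  also have "\<dots> = lookup (e1 N * p) \<alpha>"
    unfolding lookup_e1_times
    using sum.permute[OF \<pi>, of "\<lambda>i. if lookup \<alpha> i = 0 then 0 else lookup p (\<alpha> - single i 1)"]
    by (simp add: comp_def)
  finally show "lookup (e1 N * p) (map_key \<pi> \<alpha>) = lookup (e1 N * p) \<alpha>" .
qed

lemma sym_e1_power_times: "p \<in> sym_polys N n \<Longrightarrow> e1 N ^ k * p \<in> sym_polys N (n + k)"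
  by (induction k) (auto simp: mult.assoc intro: sym_e1_times)

text \<open>Every factor \<open>e1\<close> raises one entry of an exponent by one, so each exponent
  in the product dominates one that occurs in \<open>p\<close>.\<close>

lemma e1_power_times_support:
  assumes "lookup (e1 N ^ k * p) \<gamma> \<noteq> 0"
  shows "\<exists>\<alpha>. lookup p \<alpha> \<noteq> 0 \<and> (\<forall>i. lookup \<alpha> i \<le> lookup \<gamma> i)"
  using assms
proof (induction k arbitrary: \<gamma>)
  case (Suc k)
  then obtain i where "lookup (e1 N ^ k * p) (\<gamma> - single i 1) \<noteq> 0"
    unfolding power_Suc mult.assoc lookup_e1_times by (metis (mono_tags, lifting) sum.neutral)
  then obtain \<alpha> where "lookup p \<alpha> \<noteq> 0" "\<forall>j. lookup \<alpha> j \<le> lookup (\<gamma> - single i 1) j"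
    using Suc.IH by blast
  moreover have "lookup (\<gamma> - single i 1) j \<le> lookup \<gamma> j" for j
    by (simp add: lookup_minus)
  ultimately show ?case
    by (meson order_trans)
qed auto

lemma e1_power_times_nonneg:
  assumes "\<And>\<alpha>. lookup p \<alpha> \<ge> 0"
  shows "lookup (e1 N ^ k * p) \<gamma> \<ge> 0"
proof (induction k arbitrary: \<gamma>)
  case (Suc k)
  then show ?case
    unfolding power_Suc mult.assoc lookup_e1_times by (intro sum_nonneg) auto
qed (simp add: assms)

text \<open>Choosing the variable with index 1 from each of the \<open>k\<close> factors gives one
  contribution; nonnegativity of the coefficients excludes cancellation by the others.\<close>

lemma e1_power_times_ge:
  assumes "\<And>\<alpha>. lookup p \<alpha> \<ge> 0" "N \<ge> 1"
  shows "lookup p \<alpha> \<le> lookup (e1 N ^ k * p) (\<alpha> + single 1 k)"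
proof (induction k)
  case (Suc k)
  let ?q = "e1 N ^ k * p" and ?\<gamma> = "\<alpha> + single 1 (Suc k)"
  have "?\<gamma> - single 1 1 = \<alpha> + single 1 k"
    by (rule poly_mapping_eqI) (auto simp: lookup_add lookup_minus lookup_single when_def)
  then have "lookup p \<alpha> \<le> (if lookup ?\<gamma> 1 = 0 then 0 else lookup ?q (?\<gamma> - single 1 1))"
    using Suc.IH by (simp add: lookup_add)
  also have "\<dots> \<le> lookup (e1 N * ?q) ?\<gamma>"
    unfolding lookup_e1_times using assms e1_power_times_nonneg[of p N k]
    by (intro member_le_sum[of 1 _ "\<lambda>i. if lookup ?\<gamma> i = 0 then 0 else lookup ?q (?\<gamma> - single i 1)"]) auto
  finally show ?case
    by (simp add: mult.assoc)
qed simp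

section \<open>Triangularity of the modified monomial symmetric polynomials\<close>

abbreviation (input) trunc_part :: "expo \<Rightarrow> expo" where
  "trunc_part \<nu> \<equiv> Poly_Mapping.update 1 (lookup \<nu> 2) \<nu>"

lemma trunc_part_add:
  assumes "is_partition \<nu>"
  shows "\<nu> = trunc_part \<nu> + single 1 (lookup \<nu> 1 - lookup \<nu> 2)"
  using partition_antimono[OF assms, of 1 2]
  by (intro poly_mapping_eqI) (auto simp: lookup_add lookup_update lookup_single when_def)

lemma trunc_part_Parts:
  assumes "N \<ge> 1" "\<nu> \<in> Parts N n"
  shows "trunc_part \<nu> \<in> Parts N (n - (lookup \<nu> 1 - lookup \<nu> 2))" "lookup \<nu> 1 - lookup \<nu> 2 \<le> n"
proof -
  have \<nu>: "is_partition \<nu>" "\<nu> \<in> exponents N" "weight \<nu> = n"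
    using assms by (auto simp: Parts_eq Exps_def)
  have t: "trunc_part \<nu> \<in> exponents N"
    using assms(1) \<nu>(2) by (auto simp: in_exponents_iff lookup_update)
  have "weight (trunc_part \<nu> + single 1 (lookup \<nu> 1 - lookup \<nu> 2)) =
      weight (trunc_part \<nu>) + (lookup \<nu> 1 - lookup \<nu> 2)"
    by (rule weight_add_single(2)[OF t]) (use assms(1) in simp)
  then have "weight \<nu> = weight (trunc_part \<nu>) + (lookup \<nu> 1 - lookup \<nu> 2)"
    by (simp only: trunc_part_add[OF \<nu>(1), symmetric])
  moreover have "is_partition (trunc_part \<nu>)"
    using \<nu>(1) unfolding is_partition_def by (auto simp: lookup_update numeral_2_eq_2)
  ultimately show "trunc_part \<nu> \<in> Parts N (n - (lookup \<nu> 1 - lookup \<nu> 2))" "lookup \<nu> 1 - lookup \<nu> 2 \<le> n"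
    using t \<nu>(3) by (auto simp: Parts_eq Exps_def)
qed

lemma msym_tilde_in_sym_polys:
  assumes "N \<ge> 1" "\<nu> \<in> Parts N n"
  shows "msym_tilde N \<nu> \<in> sym_polys N n"
  using sym_e1_power_times[OF msym_in_sym_polys[OF trunc_part_Parts(1)[OF assms]],
      of "lookup \<nu> 1 - lookup \<nu> 2"]
  unfolding msym_tilde_def le_add_diff_inverse2[OF trunc_part_Parts(2)[OF assms]] .

text \<open>The truncated partition has coefficient 1 in its own \<open>msym\<close>, and
  multiplying by the first variable once for each factor \<open>e1\<close> restores the first part
  of \<open>\<nu>\<close>.\<close>

lemma lookup_msym_tilde_self:
  assumes "N \<ge> 1" "\<nu> \<in> Parts N n"
  shows "lookup (msym_tilde N \<nu>) \<nu> > 0"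
proof -
  have "is_partition \<nu>"
    using assms by (simp add: Parts_eq)
  have "1 = lookup (msym N (trunc_part \<nu>)) (trunc_part \<nu>)"
    using orbit_expo_self[OF trunc_part_Parts(1)[OF assms]] by (simp add: lookup_msym)
  also have "\<dots> \<le> lookup (msym_tilde N \<nu>) (trunc_part \<nu> + single 1 (lookup \<nu> 1 - lookup \<nu> 2))"
    unfolding msym_tilde_def by (rule e1_power_times_ge) (use assms in \<open>auto simp: lookup_msym\<close>)
  finally show ?thesis
    unfolding trunc_part_add[OF \<open>is_partition \<nu>\<close>, symmetric] by simp
qed

text \<open>\<open>\<sigma>\<close> dominates a rearrangement of the truncated \<open>\<nu>\<close>.
  Sorting preserves domination, and truncation changes only the first part, about which
  \<open>\<preceq>\<close> says nothing.\<close>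

lemma msym_tilde_triangular:
  assumes "\<nu> \<in> Parts N n" "\<sigma> \<in> Parts N n" "lookup (msym_tilde N \<nu>) \<sigma> \<noteq> 0"
  shows "\<sigma> \<preceq> \<nu>"
proof -
  obtain \<alpha> where \<alpha>: "lookup (msym N (trunc_part \<nu>)) \<alpha> \<noteq> 0" "\<And>i. lookup \<alpha> i \<le> lookup \<sigma> i"
    using e1_power_times_support assms(3) unfolding msym_tilde_def by blast
  then have "\<alpha> \<in> exponents N" "sort_expo N \<alpha> = trunc_part \<nu>"
    by (auto simp: lookup_msym orbit_expo_def split: if_splits)
  moreover have \<sigma>: "\<sigma> \<in> exponents N" "sort_expo N \<sigma> = \<sigma>"
    using assms(2) by (auto simp: Parts_eq Exps_def sort_expo_partition_id)
  ultimately have "lookup (trunc_part \<nu>) i \<le> lookup \<sigma> i" for i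
    using sort_expo_mono[OF _ \<sigma>(1) \<alpha>(2)] by metis
  from this[unfolded lookup_update] have "lookup \<nu> i \<le> lookup \<sigma> i" if "i \<ge> 2" for i
    using that by (metis one_less_numeral_iff semiring_norm(76) leD)
  then show ?thesis
    using assms(1,2) by (simp add: part_le_def Parts_def)
qed

text \<open>At equal weight, larger tail parts mean a smaller first part, and equal first parts
  force equality throughout. Thus the first part is a strict rank function for
  \<open>\<preceq>\<close>, used below for induction and for choosing maximal elements.\<close>

lemma part_le_first:
  assumes "N \<ge> 1" "\<sigma> \<in> Parts N n" "\<nu> \<in> Parts N n" "\<sigma> \<preceq> \<nu>"
  shows "lookup \<sigma> 1 \<le> lookup \<nu> 1" "lookup \<sigma> 1 = lookup \<nu> 1 \<Longrightarrow> \<sigma> = \<nu>"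
proof -
  have w: "weight \<alpha> = lookup \<alpha> 1 + (\<Sum>i=2..N. lookup \<alpha> i)" if "\<alpha> \<in> exponents N" for \<alpha>
    using that assms(1) by (simp add: weight_exponents sum.atLeast_Suc_atMost numeral_2_eq_2)
  have e: "\<sigma> \<in> exponents N" "\<nu> \<in> exponents N"
    using assms by (auto simp: Parts_eq Exps_def)
  have le: "lookup \<nu> i \<le> lookup \<sigma> i" if "i \<ge> 2" for i
    using assms(4) that by (simp add: part_le_def)
  have eq: "lookup \<sigma> 1 + (\<Sum>i=2..N. lookup \<sigma> i) = lookup \<nu> 1 + (\<Sum>i=2..N. lookup \<nu> i)"
    using assms(4) w[OF e(1)] w[OF e(2)] by (simp add: part_le_def)
  moreover have "(\<Sum>i=2..N. lookup \<nu> i) \<le> (\<Sum>i=2..N. lookup \<sigma> i)"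
    using le by (intro sum_mono) auto
  ultimately show "lookup \<sigma> 1 \<le> lookup \<nu> 1"
    by linarith
  assume first: "lookup \<sigma> 1 = lookup \<nu> 1"
  with eq have sums: "(\<Sum>i=2..N. lookup \<nu> i) = (\<Sum>i=2..N. lookup \<sigma> i)"
    by simp
  have rest: "lookup \<nu> i = lookup \<sigma> i" if "i \<in> {2..N}" for i
    by (rule sum_mono_inv[OF sums]) (use le that in auto)
  show "\<sigma> = \<nu>"
  proof (rule poly_mapping_eqI)
    fix k
    consider "k = 1" | "k \<in> {2..N}" | "k \<notin> {1..N}"
      by force
    then show "lookup \<sigma> k = lookup \<nu> k"
      by cases (use first rest e in \<open>auto simp: in_exponents_iff\<close>)
  qed
qed

lemma msym_tilde_independent:
  assumes "N \<ge> 1" "(\<Sum>\<rho>\<in>Parts N n. c \<rho> *\<^sub>R msym_tilde N \<rho>) = 0" "\<rho> \<in> Parts N n"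
  shows "c \<rho> = 0"
proof (rule ccontr)
  assume "c \<rho> \<noteq> 0"
  define S where "S = {\<rho> \<in> Parts N n. c \<rho> \<noteq> 0}"
  have S: "finite S" "S \<noteq> {}"
    using \<open>c \<rho> \<noteq> 0\<close> assms(3) by (auto simp: S_def)
  \<comment> \<open>Maximality of the first part isolates one term at the exponent
    \<open>\<tau>\<close>: any other \<open>\<rho>\<close> contributing there would satisfy
    \<open>\<tau> \<preceq> \<rho>\<close> and so have a larger first part.\<close>
  obtain \<tau> where \<tau>: "\<tau> \<in> S" and max: "\<And>\<sigma>. \<sigma> \<in> S \<Longrightarrow> lookup \<sigma> 1 \<le> lookup \<tau> 1"
  proof -
    have "finite ((\<lambda>\<sigma>. lookup \<sigma> 1) ` S)" "(\<lambda>\<sigma>. lookup \<sigma> 1) ` S \<noteq> {}"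
      using S by auto
    from Max_in[OF this] Max_ge[OF this(1)] that show thesis
      by (metis (no_types, lifting) imageE imageI)
  qed
  then have \<tau>P: "\<tau> \<in> Parts N n"
    by (simp add: S_def)
  have "0 = lookup (\<Sum>\<rho>\<in>Parts N n. c \<rho> *\<^sub>R msym_tilde N \<rho>) \<tau>"
    using assms(2) by simp
  also have "\<dots> = (\<Sum>\<rho>\<in>Parts N n. c \<rho> * lookup (msym_tilde N \<rho>) \<tau>)"
    by (simp add: lookup_sum lookup_scaleR)
  also have "\<dots> = (\<Sum>\<rho>\<in>Parts N n. if \<rho> = \<tau> then c \<tau> * lookup (msym_tilde N \<tau>) \<tau> else 0)"
  proof (rule sum.cong)
    fix \<rho>
    assume \<rho>: "\<rho> \<in> Parts N n"
    have "c \<rho> * lookup (msym_tilde N \<rho>) \<tau> = 0" if "\<rho> \<noteq> \<tau>"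
    proof (rule ccontr)
      assume "c \<rho> * lookup (msym_tilde N \<rho>) \<tau> \<noteq> 0"
      then have "\<rho> \<in> S" "\<tau> \<preceq> \<rho>"
        using \<rho> \<tau>P msym_tilde_triangular by (auto simp: S_def)
      then show False
        using part_le_first[OF assms(1) \<tau>P \<rho>] max[of \<rho>] that by auto
    qed
    then show "c \<rho> * lookup (msym_tilde N \<rho>) \<tau> =
      (if \<rho> = \<tau> then c \<tau> * lookup (msym_tilde N \<tau>) \<tau> else 0)"
      by auto
  qed simp
  also have "\<dots> = c \<tau> * lookup (msym_tilde N \<tau>) \<tau>"
    using \<tau>P by simp
  finally show False
    using \<tau> lookup_msym_tilde_self[OF assms(1) \<tau>P] by (auto simp: S_def)
qed

text \<open>Two distinct indices with equal values would give a vanishing combination with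
  coefficients 1 and -1, against the independence of the indexed family.\<close>

lemma inj_on_msym_tilde:
  assumes "N \<ge> 1"
  shows "inj_on (msym_tilde N) (Parts N n)"
proof (rule inj_onI, rule ccontr)
  fix \<rho> \<sigma>
  assume *: "\<rho> \<in> Parts N n" "\<sigma> \<in> Parts N n" "msym_tilde N \<rho> = msym_tilde N \<sigma>" "\<rho> \<noteq> \<sigma>"
  let ?c = "\<lambda>\<tau>. (if \<tau> = \<rho> then 1 else 0) - (if \<tau> = \<sigma> then 1 else (0::real))"
  have "(\<Sum>\<tau>\<in>Parts N n. ?c \<tau> *\<^sub>R msym_tilde N \<tau>) =
     (\<Sum>\<tau>\<in>Parts N n. if \<tau> = \<rho> then msym_tilde N \<rho> else 0) -
     (\<Sum>\<tau>\<in>Parts N n. if \<tau> = \<sigma> then msym_tilde N \<sigma> else 0)"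
    unfolding sum_subtractf[symmetric] by (rule sum.cong) (auto simp: scaleR_left_diff_distrib)
  also have "\<dots> = 0"
    using * by simp
  finally have "(\<Sum>\<tau>\<in>Parts N n. ?c \<tau> *\<^sub>R msym_tilde N \<tau>) = 0" .
  from msym_tilde_independent[OF assms this *(1)] show False
    using \<open>\<rho> \<noteq> \<sigma>\<close> by simp
qed

text \<open>Triangularity is inverted by induction on the first part:
  \<open>msym_tilde N \<nu>\<close> is a positive multiple of \<open>msym N \<nu>\<close> plus terms
  strictly below \<open>\<nu>\<close>. Tracking \<open>\<preceq>\<close> in the spanning set later
  gives the vanishing of \<open>Bcoeff\<close>.\<close>

lemma msym_in_span:
  assumes "N \<ge> 1" "\<nu> \<in> Parts N n"
  shows "msym N \<nu> \<in> span (msym_tilde N ` {\<rho> \<in> Parts N n. \<rho> \<preceq> \<nu>})"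
  using assms(2)
proof (induction "lookup \<nu> 1" arbitrary: \<nu> rule: less_induct)
  case less
  let ?V = "span (msym_tilde N ` {\<rho> \<in> Parts N n. \<rho> \<preceq> \<nu>})"
  let ?a = "lookup (msym_tilde N \<nu>)"
  have "\<nu> \<preceq> \<nu>"
    by (simp add: part_le_def)
  have below: "?a \<sigma> *\<^sub>R msym N \<sigma> \<in> ?V" if "\<sigma> \<in> Parts N n - {\<nu>}" for \<sigma>
  proof (cases "?a \<sigma> = 0")
    case False
    then have "\<sigma> \<preceq> \<nu>"
      using msym_tilde_triangular less.prems that by blast
    moreover from this have "lookup \<sigma> 1 < lookup \<nu> 1"
      using part_le_first[OF assms(1), of \<sigma> n \<nu>] that less.prems by fastforce
    ultimately have "{\<rho> \<in> Parts N n. \<rho> \<preceq> \<sigma>} \<subseteq> {\<rho> \<in> Parts N n. \<rho> \<preceq> \<nu>}"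
      and "msym N \<sigma> \<in> span (msym_tilde N ` {\<rho> \<in> Parts N n. \<rho> \<preceq> \<sigma>})"
      using that less.hyps[of \<sigma>] by (auto simp: part_le_def dest: order_trans)
    then have "msym N \<sigma> \<in> ?V"
      by (meson image_mono span_mono subsetD)
    then show ?thesis
      by (rule span_scale)
  qed (simp add: span_zero)
  have "msym_tilde N \<nu> = (\<Sum>\<sigma>\<in>Parts N n. ?a \<sigma> *\<^sub>R msym N \<sigma>)"
    using sym_expansion msym_tilde_in_sym_polys assms(1) less.prems by blast
  also have "\<dots> = ?a \<nu> *\<^sub>R msym N \<nu> + (\<Sum>\<sigma>\<in>Parts N n - {\<nu>}. ?a \<sigma> *\<^sub>R msym N \<sigma>)"
    using less.prems by (simp add: sum.remove)
  finally have "?a \<nu> *\<^sub>R msym N \<nu> =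
      msym_tilde N \<nu> - (\<Sum>\<sigma>\<in>Parts N n - {\<nu>}. ?a \<sigma> *\<^sub>R msym N \<sigma>)"
    unfolding eq_diff_eq by (rule sym)
  moreover have "\<dots> \<in> ?V"
    using below less.prems \<open>\<nu> \<preceq> \<nu>\<close> by (intro span_diff[OF span_base span_sum]) auto
  ultimately have "(1 / ?a \<nu>) *\<^sub>R (?a \<nu> *\<^sub>R msym N \<nu>) \<in> ?V"
    by (simp only: span_scale)
  then show ?case
    using lookup_msym_tilde_self[OF assms(1) less.prems] by simp
qed

lemma Bcoeff:
  assumes "N \<ge> 1" "\<nu> \<in> Parts N n"
  shows "msym N \<nu> = (\<Sum>\<rho>\<in>Parts N n. Bcoeff N \<rho> \<nu> *\<^sub>R msym_tilde N \<rho>)"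
    and "\<not> \<rho> \<preceq> \<nu> \<Longrightarrow> Bcoeff N \<rho> \<nu> = 0"
proof -
  let ?Q = "{\<rho> \<in> Parts N n. \<rho> \<preceq> \<nu>}"
  let ?coord = "\<lambda>c. (\<forall>\<rho>. \<rho> \<notin> Parts N n \<longrightarrow> c \<rho> = 0) \<and> msym N \<nu> = (\<Sum>\<rho>\<in>Parts N n. c \<rho> *\<^sub>R msym_tilde N \<rho>)"
  have inj: "inj_on (msym_tilde N) ?Q"
    using inj_on_msym_tilde[OF assms(1)] by (rule inj_on_subset) auto
  obtain u where u: "msym N \<nu> = (\<Sum>v\<in>msym_tilde N ` ?Q. u v *\<^sub>R v)"
    using msym_in_span[OF assms] by (auto simp: span_finite)
  \<comment> \<open>Extension by 0 makes \<open>c\<close> meet the support condition in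
    \<open>Bcoeff\<close> and at the same time vanish unless \<open>\<rho> \<preceq> \<nu>\<close>.
    Independence then identifies it with the described coordinate function.\<close>
  define c where "c \<rho> = (if \<rho> \<in> ?Q then u (msym_tilde N \<rho>) else 0)" for \<rho>
  have "msym N \<nu> = (\<Sum>\<rho>\<in>?Q. c \<rho> *\<^sub>R msym_tilde N \<rho>)"
    unfolding u sum.reindex[OF inj] by (rule sum.cong) (auto simp: c_def)
  also have "\<dots> = (\<Sum>\<rho>\<in>Parts N n. c \<rho> *\<^sub>R msym_tilde N \<rho>)"
    by (rule sum.mono_neutral_left) (auto simp: c_def)
  finally have c: "?coord c"
    by (auto simp: c_def)
  have "c' = c" if "?coord c'" for c'
  proof
    fix \<rho>
    have "(\<Sum>\<rho>\<in>Parts N n. (c' \<rho> - c \<rho>) *\<^sub>R msym_tilde N \<rho>) = 0"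
      using that c by (simp add: scaleR_left_diff_distrib sum_subtractf)
    from msym_tilde_independent[OF assms(1) this] show "c' \<rho> = c \<rho>"
      using that c by (cases "\<rho> \<in> Parts N n") auto
  qed
  with c have "(THE c. ?coord c) = c"
    by (intro the_equality) auto
  moreover have "weight \<nu> = n"
    using assms(2) by (simp add: Parts_def)
  ultimately have B: "Bcoeff N \<rho> \<nu> = c \<rho>" for \<rho>
    unfolding Bcoeff_def by simp
  show "msym N \<nu> = (\<Sum>\<rho>\<in>Parts N n. Bcoeff N \<rho> \<nu> *\<^sub>R msym_tilde N \<rho>)"
    using c by (simp add: B)
  show "\<not> \<rho> \<preceq> \<nu> \<Longrightarrow> Bcoeff N \<rho> \<nu> = 0"
    by (simp add: B c_def)
qed

section \<open>The pairing with harmonic polynomials\<close>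

text \<open>The ambient space of \<open>harmonic_B N \<kappa> (2 * n)\<close> before the Laplace
  equation is imposed. Exponents are written as doubles because the pairing reads \<open>f\<close>
  at \<open>\<alpha> + \<alpha>\<close>.\<close>

definition even_sym_polys :: "nat \<Rightarrow> nat \<Rightarrow> rpoly set" where
  "even_sym_polys N n = {f. (\<forall>\<gamma>. lookup f \<gamma> \<noteq> 0 \<longrightarrow> (\<exists>\<alpha>\<in>Exps N n. \<gamma> = \<alpha> + \<alpha>)) \<and>
     (\<forall>\<pi>. \<pi> permutes {1..N} \<longrightarrow> (\<forall>\<alpha>. lookup f (map_key \<pi> \<alpha>) = lookup f \<alpha>))}"

lemma double_Exps: "\<alpha> + \<alpha> \<in> Exps N (2 * n) \<longleftrightarrow> \<alpha> \<in> Exps N n"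
proof -
  have "\<alpha> + \<alpha> \<in> exponents N \<longleftrightarrow> \<alpha> \<in> exponents N"
    by (auto simp: in_exponents_iff lookup_add)
  moreover have "weight (\<alpha> + \<alpha>) = 2 * weight \<alpha>" if "\<alpha> \<in> exponents N" "\<alpha> + \<alpha> \<in> exponents N"
    using that by (simp add: weight_exponents lookup_add sum.distrib)
  ultimately show ?thesis
    by (auto simp: Exps_def)
qed

lemma even_expo_double:
  assumes "\<gamma> \<in> exponents N" "\<And>i. i \<in> {1..N} \<Longrightarrow> even (lookup \<gamma> i)"
  obtains \<alpha> where "\<gamma> = \<alpha> + \<alpha>"
proof
  have "even (lookup \<gamma> i)" for i
    using assms by (cases "i \<in> {1..N}") (auto simp: in_exponents_iff)
  then have "lookup \<gamma> i div 2 + lookup \<gamma> i div 2 = lookup \<gamma> i" for i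
    by (metis dvd_mult_div_cancel mult_2)
  then show "\<gamma> = Poly_Mapping.map (\<lambda>k. k div 2) \<gamma> + Poly_Mapping.map (\<lambda>k. k div 2) \<gamma>"
    by (intro poly_mapping_eqI) (auto simp: lookup_add map.rep_eq when_def)
qed

lemma reflect_var_eq_iff: "reflect_var i f = f \<longleftrightarrow> (\<forall>\<alpha>. lookup f \<alpha> \<noteq> 0 \<longrightarrow> even (lookup \<alpha> i))"
proof -
  have "(-1) ^ k * c = c \<longleftrightarrow> c \<noteq> 0 \<longrightarrow> even k" for k and c :: real
    by (cases "even k") auto
  then show ?thesis
    by (simp add: poly_mapping_eq_iff fun_eq_iff lookup_reflect_var)
qed

lemma psubst_perm_eq_iff:
  assumes "\<pi> permutes S"
  shows "psubst (\<lambda>i. var (\<pi> i)) f = f \<longleftrightarrow> (\<forall>\<alpha>. lookup f (map_key \<pi> \<alpha>) = lookup f \<alpha>)"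
  by (simp add: poly_mapping_eq_iff fun_eq_iff lookup_psubst_perm[OF permutes_bij[OF assms]])

lemma harmonic_B_eq:
  "harmonic_B N \<kappa> (2 * n) = {f \<in> even_sym_polys N n. dunkl_laplacian N \<kappa> f = 0}"
proof -
  have "f \<in> homogeneous_polys N (2 * n) \<and> (\<forall>i\<in>{1..N}. reflect_var i f = f) \<longleftrightarrow>
      (\<forall>\<gamma>. lookup f \<gamma> \<noteq> 0 \<longrightarrow> (\<exists>\<alpha>\<in>Exps N n. \<gamma> = \<alpha> + \<alpha>))" (is "?L \<longleftrightarrow> ?R") for f
  proof
    assume ?L
    show ?R
    proof (intro allI impI)
      fix \<gamma>
      assume "lookup f \<gamma> \<noteq> 0"
      with \<open>?L\<close> have \<gamma>: "\<gamma> \<in> Exps N (2 * n)" "\<And>i. i \<in> {1..N} \<Longrightarrow> even (lookup \<gamma> i)"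
        by (auto simp: homogeneous_polys_iff reflect_var_eq_iff)
      then obtain \<alpha> where \<alpha>: "\<gamma> = \<alpha> + \<alpha>"
        using even_expo_double[of \<gamma> N] by (auto simp: Exps_def)
      with \<gamma>(1) have "\<alpha> \<in> Exps N n"
        by (simp only: double_Exps)
      with \<alpha> show "\<exists>\<alpha>\<in>Exps N n. \<gamma> = \<alpha> + \<alpha>"
        by blast
    qed
  next
    assume R: ?R
    have "\<gamma> \<in> Exps N (2 * n) \<and> even (lookup \<gamma> i)" if nz: "lookup f \<gamma> \<noteq> 0" for \<gamma> i
    proof -
      obtain \<alpha> where "\<alpha> \<in> Exps N n" "\<gamma> = \<alpha> + \<alpha>"
        using R nz by blast
      then show ?thesis
        by (simp only: double_Exps lookup_add) simp
    qed
    then show ?L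
      by (auto simp: homogeneous_polys_iff reflect_var_eq_iff)
  qed
  then show ?thesis
    unfolding harmonic_B_def even_sym_polys_def by (auto simp: psubst_perm_eq_iff)
qed

lemma subspace_even_sym_polys: "subspace (even_sym_polys N n)"
  unfolding subspace_def even_sym_polys_def
proof (intro conjI ballI allI CollectI impI; (elim CollectE conjE)?)
  fix f g :: rpoly and \<gamma>
  assume *: "\<forall>\<gamma>. lookup f \<gamma> \<noteq> 0 \<longrightarrow> (\<exists>\<alpha>\<in>Exps N n. \<gamma> = \<alpha> + \<alpha>)"
    "\<forall>\<gamma>. lookup g \<gamma> \<noteq> 0 \<longrightarrow> (\<exists>\<alpha>\<in>Exps N n. \<gamma> = \<alpha> + \<alpha>)" "lookup (f + g) \<gamma> \<noteq> 0"
  then have "lookup f \<gamma> \<noteq> 0 \<or> lookup g \<gamma> \<noteq> 0"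
    by (auto simp: lookup_add)
  with * show "\<exists>\<alpha>\<in>Exps N n. \<gamma> = \<alpha> + \<alpha>"
    by blast
qed (auto simp: lookup_add lookup_scaleR)

lemma dunkl_laplacian_linear:
  "dunkl_laplacian N \<kappa> (f + g) = dunkl_laplacian N \<kappa> f + dunkl_laplacian N \<kappa> g"
  "dunkl_laplacian N \<kappa> (c *\<^sub>R f) = c *\<^sub>R dunkl_laplacian N \<kappa> f"
  by (rule poly_mapping_eqI;
      simp add: lookup_dunkl_laplacian lookup_add[of f g] lookup_add[of "dunkl_laplacian N \<kappa> f"]
        lookup_scaleR distrib_left sum.distrib sum_distrib_left mult.left_commute)+

lemma subspace_harmonic_B: "subspace (harmonic_B N \<kappa> (2 * n))"
proof -
  have "dunkl_laplacian N \<kappa> 0 = 0"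
    using dunkl_laplacian_linear(2)[of N \<kappa> 0 0] by simp
  then show ?thesis
    using subspace_even_sym_polys[of N n] unfolding harmonic_B_eq subspace_def
    by (simp add: dunkl_laplacian_linear)
qed

text \<open>Each summand lowers one exponent by two, which keeps parity, and a permutation only
  reorders the summands. The result makes the nondegeneracy criterion \<open>even_sym_eq_0\<close>
  applicable to the Laplacian.\<close>

lemma dunkl_laplacian_even_sym:
  assumes f: "f \<in> even_sym_polys N (Suc n)"
  shows "dunkl_laplacian N \<kappa> f \<in> even_sym_polys N n"
  unfolding even_sym_polys_def
proof (intro CollectI conjI allI impI)
  fix \<beta>
  let ?c = "\<lambda>\<beta> i. (of_nat (lookup \<beta> i + 1) + \<kappa> * (1 + (-1) ^ lookup \<beta> i)) *
    (of_nat (lookup \<beta> i + 2) + \<kappa> * (1 - (-1) ^ lookup \<beta> i))"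
  assume "lookup (dunkl_laplacian N \<kappa> f) \<beta> \<noteq> 0"
  then obtain i where i: "i \<in> {1..N}" "?c \<beta> i * lookup f (\<beta> + (single i 1 + single i 1)) \<noteq> 0"
    unfolding lookup_dunkl_laplacian by (rule sum.not_neutral_contains_not_neutral)
  from i(2) have "lookup f (\<beta> + (single i 1 + single i 1)) \<noteq> 0"
    by (rule contrapos_nn) simp
  then obtain \<gamma> where \<gamma>: "\<gamma> \<in> Exps N (Suc n)" "\<beta> + (single i 1 + single i 1) = \<gamma> + \<gamma>"
    using f by (auto simp: even_sym_polys_def)
  have eq: "lookup \<beta> k + (if k = i then 2 else 0) = lookup \<gamma> k + lookup \<gamma> k" for k
    using arg_cong[OF \<gamma>(2), of "\<lambda>\<delta>. lookup \<delta> k"]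
    by (simp add: lookup_add lookup_single when_def split: if_splits)
  \<comment> \<open>At the index \<open>i\<close> the equation reads
    \<open>lookup \<beta> i + 2 = 2 * lookup \<gamma> i\<close>, so one unit can be removed from
    \<open>\<gamma>\<close>.\<close>
  have \<gamma>i: "lookup \<gamma> i \<noteq> 0"
    using eq[of i] by auto
  define \<delta> where "\<delta> = \<gamma> - single i 1"
  have \<delta>: "\<gamma> = \<delta> + single i 1"
    using diff_add_single[OF \<gamma>i] by (simp add: \<delta>_def)
  have "\<beta> = \<delta> + \<delta>"
  proof (rule poly_mapping_eqI)
    fix k
    show "lookup \<beta> k = lookup (\<delta> + \<delta>) k"
      unfolding lookup_add using eq[of k] by (auto simp: \<delta> lookup_add[of \<delta> "single i _"] lookup_single when_def split: if_splits)
  qed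
  moreover have "\<delta> \<in> Exps N n"
  proof -
    have "\<delta> \<in> exponents N"
      using \<gamma>(1) by (auto simp: Exps_def in_exponents_iff \<delta>_def lookup_minus)
    then show ?thesis
      using \<gamma>(1) i(1) weight_add_single(2)[of \<delta> N i 1] by (simp add: Exps_def \<delta>)
  qed
  ultimately show "\<exists>\<alpha>\<in>Exps N n. \<beta> = \<alpha> + \<alpha>"
    by blast
next
  fix \<pi> \<beta>
  let ?g = "\<lambda>i. (of_nat (lookup \<beta> i + 1) + \<kappa> * (1 + (-1) ^ lookup \<beta> i)) *
    (of_nat (lookup \<beta> i + 2) + \<kappa> * (1 - (-1) ^ lookup \<beta> i)) * lookup f (\<beta> + (single i 1 + single i 1))"
  assume \<pi>: "\<pi> permutes {1..N}"
  have shift: "lookup f (map_key \<pi> \<beta> + (single i 1 + single i 1)) =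
      lookup f (\<beta> + (single (\<pi> i) 1 + single (\<pi> i) 1))" for i
  proof -
    have "map_key \<pi> \<beta> + (single i 1 + single i 1) = map_key \<pi> (\<beta> + (single (\<pi> i) 1 + single (\<pi> i) 1))"
      by (simp only: map_key_plus[OF permutes_inj[OF \<pi>]] map_key_single_perm[OF \<pi>])
    then show ?thesis
      using f \<pi> by (auto simp: even_sym_polys_def)
  qed
  have "lookup (dunkl_laplacian N \<kappa> f) (map_key \<pi> \<beta>) = (\<Sum>i=1..N. ?g (\<pi> i))"
    unfolding lookup_dunkl_laplacian lookup_map_key_perm[OF \<pi>] shift ..
  also have "\<dots> = lookup (dunkl_laplacian N \<kappa> f) \<beta>"
    unfolding lookup_dunkl_laplacian using sum.permute[OF \<pi>, of ?g] by (simp add: comp_def)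
  finally show "lookup (dunkl_laplacian N \<kappa> f) (map_key \<pi> \<beta>) = lookup (dunkl_laplacian N \<kappa> f) \<beta>" .
qed

section \<open>The weights, the pairing and its nondegeneracy\<close>

definition expo_norm :: "nat \<Rightarrow> real \<Rightarrow> expo \<Rightarrow> real" where
  "expo_norm N \<kappa> \<alpha> = expo_fact N \<alpha> * expo_pochhammer N (\<kappa> + 1 / 2) \<alpha>"

lemma expo_norm_pos: "\<kappa> \<ge> 0 \<Longrightarrow> expo_norm N \<kappa> \<alpha> > 0"
  unfolding expo_norm_def expo_fact_def expo_pochhammer_def
  by (intro mult_pos_pos prod_pos) (auto intro: pochhammer_pos)

lemma expo_norm_map_key: "\<pi> permutes {1..N} \<Longrightarrow> expo_norm N \<kappa> (map_key \<pi> \<alpha>) = expo_norm N \<kappa> \<alpha>"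
  unfolding expo_norm_def expo_fact_def expo_pochhammer_def
  by (simp only: prod_map_key_perm)

text \<open>The ratio of neighbouring weights is a quarter of the coefficient of the Dunkl Laplacian
  at the exponent \<open>\<alpha> + \<alpha>\<close>. This is the source of the factor 4 in the
  adjointness relation.\<close>

lemma expo_norm_add_single:
  assumes "i \<in> {1..N}"
  shows "expo_norm N \<kappa> (\<alpha> + single i 1) =
    expo_norm N \<kappa> \<alpha> * (of_nat (lookup \<alpha> i + 1) * (\<kappa> + 1 / 2 + of_nat (lookup \<alpha> i)))"
proof -
  have shift: "(\<Prod>j=1..N. g (lookup (\<alpha> + single i 1) j)) = (\<Prod>j=1..N. g (lookup \<alpha> j)) * c"
    if "g (lookup \<alpha> i + 1) = g (lookup \<alpha> i) * c" for g :: "nat \<Rightarrow> real" and c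
  proof -
    have "(\<Prod>j\<in>{1..N} - {i}. g (lookup (\<alpha> + single i 1) j)) = (\<Prod>j\<in>{1..N} - {i}. g (lookup \<alpha> j))"
      by (rule prod.cong) (auto simp: lookup_add lookup_single when_def)
    then show ?thesis
      using that by (simp only: prod.remove[OF finite_atLeastAtMost assms] lookup_add lookup_single_eq
          mult.commute mult.left_commute)
  qed
  have "expo_fact N (\<alpha> + single i 1) = expo_fact N \<alpha> * of_nat (lookup \<alpha> i + 1)"
    unfolding expo_fact_def by (rule shift) (simp add: mult.commute)
  moreover have "expo_pochhammer N t (\<alpha> + single i 1) = expo_pochhammer N t \<alpha> * (t + of_nat (lookup \<alpha> i))" for t
    unfolding expo_pochhammer_def by (rule shift) (simp add: pochhammer_rec')
  ultimately show ?thesis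
    unfolding expo_norm_def by simp
qed

text \<open>Bilinear, but the arguments live in different degrees: \<open>f\<close> is read at
  doubled exponents of weight \<open>2 * n\<close>, \<open>p\<close> at exponents of weight
  \<open>n\<close>.\<close>

definition harmonic_pairing :: "nat \<Rightarrow> real \<Rightarrow> nat \<Rightarrow> rpoly \<Rightarrow> rpoly \<Rightarrow> real" where
  "harmonic_pairing N \<kappa> n f p =
    (\<Sum>\<alpha>\<in>Exps N n. lookup p \<alpha> * (lookup f (\<alpha> + \<alpha>) * expo_norm N \<kappa> \<alpha>))"

lemma harmonic_pairing_sum_right:
  "harmonic_pairing N \<kappa> n f (\<Sum>i\<in>I. c i *\<^sub>R p i) = (\<Sum>i\<in>I. c i * harmonic_pairing N \<kappa> n f (p i))"
  unfolding harmonic_pairing_def sum_distrib_left lookup_sum lookup_scaleR sum_distrib_right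
  by (subst sum.swap) (simp add: mult.assoc)

lemma harmonic_pairing_sum_left:
  "harmonic_pairing N \<kappa> n (\<Sum>i\<in>I. c i *\<^sub>R f i) p = (\<Sum>i\<in>I. c i * harmonic_pairing N \<kappa> n (f i) p)"
  unfolding harmonic_pairing_def sum_distrib_left lookup_sum lookup_scaleR sum_distrib_right
  by (subst sum.swap) (simp add: mult.assoc mult.left_commute)

lemma harmonic_pairing_zero_left: "harmonic_pairing N \<kappa> n 0 p = 0"
  by (simp add: harmonic_pairing_def)

lemma harmonic_pairing_diff_left:
  "harmonic_pairing N \<kappa> n (f - g) p = harmonic_pairing N \<kappa> n f p - harmonic_pairing N \<kappa> n g p"
  unfolding harmonic_pairing_def sum_subtractf[symmetric]
  by (simp add: lookup_minus[of f g] algebra_simps)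

text \<open>Adjointness of the Laplacian and multiplication by \<open>e1\<close>: the sum over
  exponents of weight \<open>Suc n\<close> divisible by the \<open>i\<close>-th variable is
  reindexed by removing that variable, and the ratio of weights supplies the Laplacian
  coefficient.\<close>

lemma harmonic_pairing_e1_times:
  "harmonic_pairing N \<kappa> (Suc n) f (e1 N * p) = harmonic_pairing N \<kappa> n (dunkl_laplacian N \<kappa> f) p / 4"
proof -
  define W where "W \<gamma> = lookup f (\<gamma> + \<gamma>) * expo_norm N \<kappa> \<gamma>" for \<gamma>
  have inner: "(\<Sum>\<gamma>\<in>Exps N (Suc n). (if lookup \<gamma> i = 0 then 0 else lookup p (\<gamma> - single i 1)) * W \<gamma>) =
      (\<Sum>\<alpha>\<in>Exps N n. lookup p \<alpha> * W (\<alpha> + single i 1))" if i: "i \<in> {1..N}" for i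
  proof -
    have "(\<Sum>\<gamma>\<in>Exps N (Suc n). (if lookup \<gamma> i = 0 then 0 else lookup p (\<gamma> - single i 1)) * W \<gamma>) =
      (\<Sum>\<gamma>\<in>{\<gamma> \<in> Exps N (Suc n). lookup \<gamma> i \<noteq> 0}. lookup p (\<gamma> - single i 1) * W \<gamma>)"
      by (rule sum.mono_neutral_cong_right) auto
    also have "\<dots> = (\<Sum>\<alpha>\<in>Exps N n. lookup p \<alpha> * W (\<alpha> + single i 1))"
    proof (rule sum.reindex_bij_witness[of _ "\<lambda>\<alpha>. \<alpha> + single i 1" "\<lambda>\<gamma>. \<gamma> - single i 1"])
      fix \<gamma>
      assume \<gamma>: "\<gamma> \<in> {\<gamma> \<in> Exps N (Suc n). lookup \<gamma> i \<noteq> 0}"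
      then show eq: "\<gamma> - single i 1 + single i 1 = \<gamma>"
        using diff_add_single by blast
      have e: "\<gamma> - single i 1 \<in> exponents N"
        using \<gamma> by (auto simp: Exps_def in_exponents_iff lookup_minus)
      with weight_add_single(2)[OF e i, of 1] \<gamma> show "\<gamma> - single i 1 \<in> Exps N n"
        unfolding eq by (simp add: Exps_def)
      show "lookup p (\<gamma> - single i 1) * W (\<gamma> - single i 1 + single i 1) = lookup p (\<gamma> - single i 1) * W \<gamma>"
        by (simp only: eq)
    next
      fix \<alpha>
      assume "\<alpha> \<in> Exps N n"
      then show "\<alpha> + single i 1 \<in> {\<gamma> \<in> Exps N (Suc n). lookup \<gamma> i \<noteq> 0}"
        using Exps_add_single[of \<alpha> N n i 1] i by (simp add: lookup_add)
    qed simp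
    finally show ?thesis .
  qed
  have "harmonic_pairing N \<kappa> (Suc n) f (e1 N * p) =
     (\<Sum>\<gamma>\<in>Exps N (Suc n). \<Sum>i=1..N. (if lookup \<gamma> i = 0 then 0 else lookup p (\<gamma> - single i 1)) * W \<gamma>)"
    unfolding harmonic_pairing_def lookup_e1_times W_def sum_distrib_right ..
  also have "\<dots> = (\<Sum>i=1..N. \<Sum>\<alpha>\<in>Exps N n. lookup p \<alpha> * W (\<alpha> + single i 1))"
    by (subst sum.swap) (simp only: inner cong: sum.cong)
  also have "\<dots> = (\<Sum>\<alpha>\<in>Exps N n. \<Sum>i=1..N. lookup p \<alpha> * W (\<alpha> + single i 1))"
    by (rule sum.swap)
  also have "\<dots> = harmonic_pairing N \<kappa> n (dunkl_laplacian N \<kappa> f) p / 4"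
    unfolding harmonic_pairing_def lookup_dunkl_laplacian sum_divide_distrib sum_distrib_left sum_distrib_right
  proof (intro sum.cong refl)
    fix \<alpha> :: expo and i
    assume i: "i \<in> {1..N}"
    have swap: "\<alpha> + single i 1 + (\<alpha> + single i 1) = \<alpha> + \<alpha> + (single i 1 + single i 1)"
      by (simp only: ac_simps)
    \<comment> \<open>All entries of \<open>\<alpha> + \<alpha>\<close> are even, so the sign terms
      reduce to \<open>2 * \<kappa>\<close> in the first factor and 0 in the second.\<close>
    show "lookup p \<alpha> * W (\<alpha> + single i 1) =
      lookup p \<alpha> * ((of_nat (lookup (\<alpha> + \<alpha>) i + 1) + \<kappa> * (1 + (-1) ^ lookup (\<alpha> + \<alpha>) i)) *
        (of_nat (lookup (\<alpha> + \<alpha>) i + 2) + \<kappa> * (1 - (-1) ^ lookup (\<alpha> + \<alpha>) i)) *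
        lookup f (\<alpha> + \<alpha> + (single i 1 + single i 1)) * expo_norm N \<kappa> \<alpha>) / 4"
      unfolding W_def expo_norm_add_single[OF i] swap lookup_add[of \<alpha> \<alpha>]
      by (simp add: field_simps)
  qed
  finally show ?thesis .
qed

lemma even_sym_lookup_orbit:
  assumes "f \<in> even_sym_polys N n" "\<alpha> \<in> orbit_expo N \<nu>"
  shows "lookup f (\<alpha> + \<alpha>) = lookup f (\<nu> + \<nu>)" "expo_norm N \<kappa> \<alpha> = expo_norm N \<kappa> \<nu>"
proof -
  have \<alpha>: "\<alpha> \<in> exponents N" "sort_expo N \<alpha> = \<nu>"
    using assms(2) by (auto simp: orbit_expo_def)
  obtain \<pi> where \<pi>: "\<pi> permutes {1..N}" "sort_expo N \<alpha> = map_key \<pi> \<alpha>"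
    using sort_expo_perm[OF \<alpha>(1)] .
  have "\<nu> + \<nu> = map_key \<pi> (\<alpha> + \<alpha>)"
    unfolding map_key_plus[OF permutes_inj[OF \<pi>(1)]] using \<alpha> \<pi> by simp
  then show "lookup f (\<alpha> + \<alpha>) = lookup f (\<nu> + \<nu>)"
    using assms(1) \<pi>(1) unfolding even_sym_polys_def by simp
  show "expo_norm N \<kappa> \<alpha> = expo_norm N \<kappa> \<nu>"
    using expo_norm_map_key[OF \<pi>(1)] \<pi> \<alpha> by metis
qed

text \<open>Both \<open>f\<close> at doubled exponents and the weight are constant on an orbit, so
  this pairing detects one coefficient of \<open>f\<close>.\<close>

lemma harmonic_pairing_msym:
  assumes "f \<in> even_sym_polys N n" "\<nu> \<in> Parts N n"
  shows "harmonic_pairing N \<kappa> n f (msym N \<nu>) =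
    of_nat (card (orbit_expo N \<nu>)) * (lookup f (\<nu> + \<nu>) * expo_norm N \<kappa> \<nu>)"
proof -
  have "harmonic_pairing N \<kappa> n f (msym N \<nu>) =
    (\<Sum>\<alpha>\<in>orbit_expo N \<nu>. lookup f (\<alpha> + \<alpha>) * expo_norm N \<kappa> \<alpha>)"
    unfolding harmonic_pairing_def lookup_msym
    by (rule sum.mono_neutral_cong_right) (use orbit_expo_Parts_subset[OF assms(2)] in auto)
  also have "\<dots> = (\<Sum>\<alpha>\<in>orbit_expo N \<nu>. lookup f (\<nu> + \<nu>) * expo_norm N \<kappa> \<nu>)"
    using even_sym_lookup_orbit[OF assms(1)] by (intro sum.cong) metis+
  finally show ?thesis
    by simp
qed

lemma orbit_expo_nonempty: "\<nu> \<in> Parts N n \<Longrightarrow> orbit_expo N \<nu> \<noteq> {}"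
  using orbit_expo_self by blast

text \<open>Nondegeneracy on the left: orbit sizes and weights are positive, the latter by
  \<open>\<kappa> \<ge> 0\<close>, so the pairings determine the coefficients at doubled partitions,
  and symmetry determines the rest.\<close>

lemma even_sym_eq_0:
  assumes "\<kappa> \<ge> 0" "f \<in> even_sym_polys N n"
    and zero: "\<And>\<nu>. \<nu> \<in> Parts N n \<Longrightarrow> harmonic_pairing N \<kappa> n f (msym N \<nu>) = 0"
  shows "f = 0"
proof (rule poly_mapping_eqI)
  fix \<gamma>
  have diag: "lookup f (\<nu> + \<nu>) = 0" if \<nu>: "\<nu> \<in> Parts N n" for \<nu>
    using zero[OF \<nu>] expo_norm_pos[OF assms(1), of N \<nu>] orbit_expo_nonempty[OF \<nu>]
    unfolding harmonic_pairing_msym[OF assms(2) \<nu>] by simp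
  show "lookup f \<gamma> = lookup 0 \<gamma>"
  proof (rule ccontr)
    assume "lookup f \<gamma> \<noteq> lookup 0 \<gamma>"
    then obtain \<alpha> where \<alpha>: "\<alpha> \<in> Exps N n" "\<gamma> = \<alpha> + \<alpha>" "lookup f (\<alpha> + \<alpha>) \<noteq> 0"
      using assms(2) by (auto simp: even_sym_polys_def)
    then have "\<alpha> \<in> orbit_expo N (sort_expo N \<alpha>)"
      by (simp add: orbit_expo_def Exps_def)
    from even_sym_lookup_orbit(1)[OF assms(2) this] diag[OF sort_expo_Parts[OF \<alpha>(1)]] \<alpha>(3)
    show False
      by simp
  qed
qed

section \<open>The polynomials \<open>hpoly\<close>\<close>

text \<open>Thus the normalization by the value at the all-ones point in \<open>hpoly\<close>
  cancels the orbit size that the pairing with \<open>msym\<close> produces.\<close>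

lemma psubst_one_msym: "psubst (\<lambda>_. 1 :: real) (msym N \<nu>) = of_nat (card (orbit_expo N \<nu>))"
proof -
  have "keys (msym N \<nu>) = orbit_expo N \<nu>"
    by (auto simp: in_keys_iff lookup_msym split: if_splits)
  then show ?thesis
    unfolding psubst_def by (simp add: lookup_msym)
qed

lemma lookup_hpoly:
  assumes "\<mu> \<in> Parts N n"
  shows "lookup (hpoly N \<kappa> \<mu>) \<gamma> = (\<Sum>\<nu> | \<nu> \<in> Parts N n \<and> \<mu> \<preceq> \<nu>.
    Bcoeff N \<mu> \<nu> / (2 ^ n * expo_norm N \<kappa> \<nu> * card (orbit_expo N \<nu>)) *
    lookup (psubst (\<lambda>i. var i ^ 2) (msym N \<nu>)) \<gamma>)"
proof -
  have "weight \<mu> = n"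
    using assms by (simp add: Parts_def)
  then show ?thesis
    unfolding hpoly_def psubst_one_msym
    by (simp add: lookup_scaleR lookup_sum sum_distrib_left expo_norm_def mult.assoc)
qed

lemma psubst_square_msym_even_sym:
  assumes "\<nu> \<in> Parts N n"
  shows "psubst (\<lambda>i. var i ^ 2) (msym N \<nu>) \<in> even_sym_polys N n"
  unfolding even_sym_polys_def
proof (intro CollectI conjI allI impI)
  let ?f = "psubst (\<lambda>i. var i ^ 2) (msym N \<nu>)"
  fix \<gamma>
  assume "lookup ?f \<gamma> \<noteq> 0"
  then obtain \<alpha> where "\<gamma> = \<alpha> + \<alpha>" "lookup (msym N \<nu>) \<alpha> \<noteq> 0"
    by (metis lookup_psubst_square)
  then show "\<exists>\<alpha>\<in>Exps N n. \<gamma> = \<alpha> + \<alpha>"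
    using orbit_expo_Parts_subset[OF assms] by (auto simp: lookup_msym split: if_splits)
next
  let ?f = "psubst (\<lambda>i. var i ^ 2) (msym N \<nu>)"
  fix \<pi> \<gamma>
  assume \<pi>: "\<pi> permutes {1..N}"
  show "lookup ?f (map_key \<pi> \<gamma>) = lookup ?f \<gamma>"
  proof (cases "\<exists>\<alpha>. \<gamma> = \<alpha> + \<alpha>")
    case True
    then obtain \<alpha> where "\<gamma> = \<alpha> + \<alpha>"
      by blast
    show ?thesis
      unfolding \<open>\<gamma> = \<alpha> + \<alpha>\<close> map_key_plus[OF permutes_inj[OF \<pi>]] lookup_psubst_square(1)
        lookup_msym orbit_expo_map_key[OF \<pi>] ..
  next
    case False
    have "\<nexists>\<alpha>. map_key \<pi> \<gamma> = \<alpha> + \<alpha>"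
    proof
      assume "\<exists>\<alpha>. map_key \<pi> \<gamma> = \<alpha> + \<alpha>"
      then obtain \<alpha> where "map_key \<pi> \<gamma> = \<alpha> + \<alpha>"
        by blast
      then have "map_key (inv \<pi>) (map_key \<pi> \<gamma>) = map_key (inv \<pi>) \<alpha> + map_key (inv \<pi>) \<alpha>"
        by (simp only: map_key_plus[OF permutes_inj[OF permutes_inv[OF \<pi>]]])
      then show False
        using False unfolding map_key_inv_perm[OF \<pi>] by blast
    qed
    from lookup_psubst_square(2)[OF this] lookup_psubst_square(2)[OF False] show ?thesis
      by simp
  qed
qed

lemma hpoly_even_sym:
  assumes "\<mu> \<in> Parts N n"
  shows "hpoly N \<kappa> \<mu> \<in> even_sym_polys N n"
proof -
  have "weight \<mu> = n"
    using assms by (simp add: Parts_def)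
  then show ?thesis
    unfolding hpoly_def
    by (intro subspace_scale[OF subspace_even_sym_polys] subspace_sum[OF subspace_even_sym_polys]
        psubst_square_msym_even_sym) auto
qed

text \<open>At the exponent \<open>\<nu> + \<nu>\<close> only the summand for \<open>\<nu>\<close>
  in \<open>hpoly\<close> contributes, and its two denominators cancel against the weight and the
  orbit size.\<close>

lemma harmonic_pairing_hpoly_msym:
  assumes "N \<ge> 1" "\<kappa> \<ge> 0" "\<mu> \<in> Parts N n" "\<nu> \<in> Parts N n"
  shows "harmonic_pairing N \<kappa> n (hpoly N \<kappa> \<mu>) (msym N \<nu>) = Bcoeff N \<mu> \<nu> / 2 ^ n"
proof -
  let ?c = "\<lambda>\<nu>. Bcoeff N \<mu> \<nu> / (2 ^ n * expo_norm N \<kappa> \<nu> * card (orbit_expo N \<nu>))"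
  have "\<nu> \<in> orbit_expo N \<sigma> \<longleftrightarrow> \<sigma> = \<nu>" for \<sigma>
    using orbit_expo_self[OF assms(4)] by (auto simp: orbit_expo_def)
  then have "lookup (hpoly N \<kappa> \<mu>) (\<nu> + \<nu>) = (\<Sum>\<sigma> | \<sigma> \<in> Parts N n \<and> \<mu> \<preceq> \<sigma>. if \<sigma> = \<nu> then ?c \<nu> else 0)"
    unfolding lookup_hpoly[OF assms(3)] lookup_psubst_square(1) lookup_msym
    by (intro sum.cong) auto
  \<comment> \<open>If \<open>\<mu> \<preceq> \<nu>\<close> fails, then \<open>\<nu>\<close> is
    outside the index set and the sum is 0; the formula still holds because
    \<open>Bcoeff N \<mu> \<nu>\<close> is 0 as well.\<close>
  also have "\<dots> = ?c \<nu>"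
    using assms(4) Bcoeff(2)[OF assms(1) assms(4), of \<mu>] by simp
  finally show ?thesis
    unfolding harmonic_pairing_msym[OF hpoly_even_sym[OF assms(3)] assms(4)]
    using orbit_expo_nonempty[OF assms(4)] expo_norm_pos[OF assms(2), of N \<nu>] by simp
qed

text \<open>Duality. Expanding \<open>msym_tilde N \<rho>\<close> in the \<open>msym\<close> and
  these back in the \<open>msym_tilde\<close>, independence shows that \<open>Bcoeff\<close> inverts
  the matrix of the first expansion, and the pairing is an entry of the product.\<close>

lemma harmonic_pairing_hpoly_msym_tilde:
  assumes "N \<ge> 1" "\<kappa> \<ge> 0" "\<mu> \<in> Parts N n" "\<rho> \<in> Parts N n"
  shows "harmonic_pairing N \<kappa> n (hpoly N \<kappa> \<mu>) (msym_tilde N \<rho>) = (if \<mu> = \<rho> then 1 / 2 ^ n else 0)"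
proof -
  let ?a = "lookup (msym_tilde N \<rho>)"
  have expand: "msym_tilde N \<rho> = (\<Sum>\<sigma>\<in>Parts N n. ?a \<sigma> *\<^sub>R msym N \<sigma>)"
    using sym_expansion msym_tilde_in_sym_polys assms(1,4) by blast
  also have "\<dots> = (\<Sum>\<sigma>\<in>Parts N n. \<Sum>\<tau>\<in>Parts N n. (?a \<sigma> * Bcoeff N \<tau> \<sigma>) *\<^sub>R msym_tilde N \<tau>)"
  proof (intro sum.cong refl)
    fix \<sigma>
    assume "\<sigma> \<in> Parts N n"
    show "?a \<sigma> *\<^sub>R msym N \<sigma> = (\<Sum>\<tau>\<in>Parts N n. (?a \<sigma> * Bcoeff N \<tau> \<sigma>) *\<^sub>R msym_tilde N \<tau>)"
      by (subst Bcoeff(1)[OF assms(1) \<open>\<sigma> \<in> Parts N n\<close>]) (simp add: scaleR_sum_right)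
  qed
  also have "\<dots> = (\<Sum>\<tau>\<in>Parts N n. (\<Sum>\<sigma>\<in>Parts N n. ?a \<sigma> * Bcoeff N \<tau> \<sigma>) *\<^sub>R msym_tilde N \<tau>)"
    unfolding scaleR_sum_left by (rule sum.swap)
  finally have "(\<Sum>\<tau>\<in>Parts N n. (\<Sum>\<sigma>\<in>Parts N n. ?a \<sigma> * Bcoeff N \<tau> \<sigma>) *\<^sub>R msym_tilde N \<tau>) =
      (\<Sum>\<tau>\<in>Parts N n. if \<tau> = \<rho> then msym_tilde N \<rho> else 0)"
    using assms(4) by simp
  then have "(\<Sum>\<tau>\<in>Parts N n. ((\<Sum>\<sigma>\<in>Parts N n. ?a \<sigma> * Bcoeff N \<tau> \<sigma>) - (if \<tau> = \<rho> then 1 else 0)) *\<^sub>R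
      msym_tilde N \<tau>) = 0"
    by (simp add: scaleR_left_diff_distrib sum_subtractf if_distrib[of "\<lambda>c. c *\<^sub>R _"] assms(4) cong: if_cong)
  from msym_tilde_independent[OF assms(1) this assms(3)]
  have "(\<Sum>\<sigma>\<in>Parts N n. ?a \<sigma> * Bcoeff N \<mu> \<sigma>) = (if \<mu> = \<rho> then 1 else 0)"
    by simp
  moreover have "harmonic_pairing N \<kappa> n (hpoly N \<kappa> \<mu>) (msym_tilde N \<rho>) =
      (\<Sum>\<sigma>\<in>Parts N n. ?a \<sigma> * Bcoeff N \<mu> \<sigma>) / 2 ^ n"
    by (subst expand) (simp add: harmonic_pairing_sum_right harmonic_pairing_hpoly_msym[OF assms(1-3)]
        sum_divide_distrib)
  ultimately show ?thesis
    by simp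
qed

text \<open>Raising the first part leaves the truncated partition alone and widens the gap between
  the first two parts by one, which is one more factor \<open>e1\<close>. A positive gap excludes
  membership in \<open>Parts_tilde\<close>.\<close>

lemma e1_times_msym_tilde:
  assumes "N \<ge> 1" "\<rho> \<in> Parts N n"
  shows "e1 N * msym_tilde N \<rho> = msym_tilde N (\<rho> + single 1 1)"
    and "\<rho> + single 1 1 \<in> Parts N (Suc n) - Parts_tilde N (Suc n)"
proof -
  have \<rho>: "is_partition \<rho>" "\<rho> \<in> Exps N n" "lookup \<rho> 2 \<le> lookup \<rho> 1"
    using assms(2) partition_antimono[of \<rho> 1 2] by (auto simp: Parts_eq)
  have l: "lookup (\<rho> + single 1 1) 1 = Suc (lookup \<rho> 1)" "lookup (\<rho> + single 1 1) 2 = lookup \<rho> 2"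
    by (simp_all add: lookup_add lookup_single)
  have "trunc_part (\<rho> + single 1 1) = trunc_part \<rho>"
    by (rule poly_mapping_eqI) (auto simp: lookup_update lookup_add lookup_single)
  then show "e1 N * msym_tilde N \<rho> = msym_tilde N (\<rho> + single 1 1)"
    unfolding msym_tilde_def l using \<rho>(3) by (simp add: Suc_diff_le mult.assoc)
  have "is_partition (\<rho> + single 1 1)"
    using \<rho>(1) unfolding is_partition_def by (auto simp: lookup_add lookup_single when_def le_SucI)
  then show "\<rho> + single 1 1 \<in> Parts N (Suc n) - Parts_tilde N (Suc n)"
    using Exps_add_single[OF \<rho>(2), of 1 1] assms(1) \<rho>(3) l
    by (simp add: Parts_eq Parts_tilde_def)
qed

text \<open>By adjointness it suffices that \<open>hpoly N \<kappa> \<mu>\<close> annihilates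
  \<open>e1 N * msym N \<nu>\<close>. That product expands in \<open>msym_tilde\<close> at
  partitions outside \<open>Parts_tilde\<close>, none of which is \<open>\<mu>\<close>, so duality
  gives 0.\<close>

lemma hpoly_harmonic:
  assumes "N \<ge> 1" "\<kappa> \<ge> 0" "\<mu> \<in> Parts_tilde N (Suc n)"
  shows "hpoly N \<kappa> \<mu> \<in> harmonic_B N \<kappa> (2 * Suc n)"
proof -
  have \<mu>: "\<mu> \<in> Parts N (Suc n)"
    using assms(3) by (simp add: Parts_tilde_def)
  have "dunkl_laplacian N \<kappa> (hpoly N \<kappa> \<mu>) = 0"
  proof (rule even_sym_eq_0[OF assms(2) dunkl_laplacian_even_sym[OF hpoly_even_sym[OF \<mu>]]])
    fix \<nu>
    assume \<nu>: "\<nu> \<in> Parts N n"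
    have "harmonic_pairing N \<kappa> (Suc n) (hpoly N \<kappa> \<mu>) (msym_tilde N (\<rho> + single 1 1)) = 0"
      if "\<rho> \<in> Parts N n" for \<rho>
      using e1_times_msym_tilde(2)[OF assms(1) that] assms(3)
        harmonic_pairing_hpoly_msym_tilde[OF assms(1,2) \<mu>, of "\<rho> + single 1 1"] by auto
    moreover have "e1 N * msym N \<nu> =
        (\<Sum>\<rho>\<in>Parts N n. Bcoeff N \<rho> \<nu> *\<^sub>R msym_tilde N (\<rho> + single 1 1))"
      by (subst Bcoeff(1)[OF assms(1) \<nu>])
        (simp only: sum_distrib_left mult_scaleR_right e1_times_msym_tilde(1)[OF assms(1)] cong: sum.cong)
    ultimately have "harmonic_pairing N \<kappa> (Suc n) (hpoly N \<kappa> \<mu>) (e1 N * msym N \<nu>) = 0"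
      by (simp add: harmonic_pairing_sum_right)
    then show "harmonic_pairing N \<kappa> n (dunkl_laplacian N \<kappa> (hpoly N \<kappa> \<mu>)) (msym N \<nu>) = 0"
      by (simp add: harmonic_pairing_e1_times)
  qed
  with hpoly_even_sym[OF \<mu>] show ?thesis
    unfolding harmonic_B_eq by simp
qed

text \<open>Both sides have the same pairing with every \<open>msym_tilde N \<rho>\<close>, hence
  with every \<open>msym\<close>, and nondegeneracy applies. The power of 2 offsets the value
  \<open>1 / 2 ^ Suc n\<close> in the duality.\<close>

lemma harmonic_B_eq_sum_hpoly:
  assumes "N \<ge> 1" "\<kappa> \<ge> 0" "f \<in> harmonic_B N \<kappa> (2 * Suc n)"
  shows "f = (\<Sum>\<mu>\<in>Parts_tilde N (Suc n).
    (2 ^ Suc n * harmonic_pairing N \<kappa> (Suc n) f (msym_tilde N \<mu>)) *\<^sub>R hpoly N \<kappa> \<mu>)"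
proof -
  let ?n = "Suc n"
  let ?P = "Parts_tilde N ?n"
  let ?h = "\<Sum>\<mu>\<in>?P. (2 ^ ?n * harmonic_pairing N \<kappa> ?n f (msym_tilde N \<mu>)) *\<^sub>R hpoly N \<kappa> \<mu>"
  have f: "f \<in> even_sym_polys N ?n" "dunkl_laplacian N \<kappa> f = 0"
    using assms(3) unfolding harmonic_B_eq by auto
  have sub: "?P \<subseteq> Parts N ?n"
    by (auto simp: Parts_tilde_def)
  then have fin: "finite ?P"
    by (rule finite_subset) simp
  have tilde: "harmonic_pairing N \<kappa> ?n (f - ?h) (msym_tilde N \<rho>) = 0" if \<rho>: "\<rho> \<in> Parts N ?n" for \<rho>
  proof -
    have "harmonic_pairing N \<kappa> ?n ?h (msym_tilde N \<rho>) =
      (\<Sum>\<mu>\<in>?P. if \<mu> = \<rho> then harmonic_pairing N \<kappa> ?n f (msym_tilde N \<rho>) else 0)"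
      unfolding harmonic_pairing_sum_left
      using harmonic_pairing_hpoly_msym_tilde[OF assms(1,2) _ \<rho>] sub by (intro sum.cong) auto
    also have "\<dots> = (if \<rho> \<in> ?P then harmonic_pairing N \<kappa> ?n f (msym_tilde N \<rho>) else 0)"
      using fin by simp
    also have "\<dots> = harmonic_pairing N \<kappa> ?n f (msym_tilde N \<rho>)"
    proof (cases "\<rho> \<in> ?P")
      case False
      have "lookup \<rho> 2 \<le> lookup \<rho> 1"
        using \<rho> partition_antimono[of \<rho> 1 2] by (simp add: Parts_eq)
      \<comment> \<open>Outside \<open>Parts_tilde\<close> the gap is positive, so
        \<open>msym_tilde N \<rho>\<close> is a multiple of \<open>e1 N\<close>, which a harmonic
        \<open>f\<close> annihilates.\<close>
      then obtain k where "lookup \<rho> 1 - lookup \<rho> 2 = Suc k"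
        using False \<rho> by (cases "lookup \<rho> 1 - lookup \<rho> 2") (auto simp: Parts_tilde_def)
      then have "\<exists>q. msym_tilde N \<rho> = e1 N * q"
        unfolding msym_tilde_def by (auto simp: mult.assoc)
      then have "harmonic_pairing N \<kappa> ?n f (msym_tilde N \<rho>) = 0"
        using f(2) by (auto simp: harmonic_pairing_e1_times harmonic_pairing_zero_left)
      then show ?thesis
        by simp
    qed simp
    finally show ?thesis
      by (simp add: harmonic_pairing_diff_left)
  qed
  have "f - ?h = 0"
  proof (rule even_sym_eq_0[OF assms(2)])
    show "f - ?h \<in> even_sym_polys N ?n"
      using sub f(1) by (intro subspace_diff[OF subspace_even_sym_polys] subspace_sum[OF subspace_even_sym_polys]
        subspace_scale[OF subspace_even_sym_polys] hpoly_even_sym) auto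
    show "harmonic_pairing N \<kappa> ?n (f - ?h) (msym N \<nu>) = 0" if "\<nu> \<in> Parts N ?n" for \<nu>
      by (subst Bcoeff(1)[OF assms(1) that]) 
        (simp only: harmonic_pairing_sum_right tilde mult_zero_right sum.neutral_const cong: sum.cong)
  qed
  then show ?thesis
    by simp
qed

theorem corollary2:
  fixes N n :: nat and \<kappa> :: real
  assumes "N \<ge> 1" and "n \<ge> 1" and "\<kappa> \<ge> 0"
  shows "inj_on (hpoly N \<kappa>) (Parts_tilde N n) \<and>
         independent (hpoly N \<kappa> ` Parts_tilde N n) \<and>
         span (hpoly N \<kappa> ` Parts_tilde N n) = harmonic_B N \<kappa> (2 * n)"
proof -
  let ?P = "Parts_tilde N n"
  \<comment> \<open>The adjointness relation links the weights \<open>Suc m\<close> and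
    \<open>m\<close>; this is where \<open>n \<ge> 1\<close> enters.\<close>
  obtain m where n: "n = Suc m"
    using assms(2) by (cases n) auto
  have sub: "?P \<subseteq> Parts N n"
    by (auto simp: Parts_tilde_def)
  then have fin: "finite ?P"
    by (rule finite_subset) simp
  note dual = harmonic_pairing_hpoly_msym_tilde[OF assms(1,3) subsetD[OF sub] subsetD[OF sub]]
  have inj: "inj_on (hpoly N \<kappa>) ?P"
  proof (rule inj_onI)
    fix \<mu> \<rho>
    assume *: "\<mu> \<in> ?P" "\<rho> \<in> ?P" "hpoly N \<kappa> \<mu> = hpoly N \<kappa> \<rho>"
    \<comment> \<open>Pairing the common polynomial with \<open>msym_tilde N \<rho>\<close> gives
      the nonzero value \<open>1 / 2 ^ n\<close>, which for \<open>hpoly N \<kappa> \<mu>\<close>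
      occurs only at \<open>\<mu> = \<rho>\<close>.\<close>
    from dual[OF *(1,2)] dual[OF *(2,2)] *(3) show "\<mu> = \<rho>"
      by (simp split: if_splits)
  qed
  have "independent (hpoly N \<kappa> ` ?P)"
  proof (rule independent_if_scalars_zero)
    fix u h
    assume zero: "(\<Sum>x\<in>hpoly N \<kappa> ` ?P. u x *\<^sub>R x) = 0" and "h \<in> hpoly N \<kappa> ` ?P"
    then obtain \<rho> where \<rho>: "\<rho> \<in> ?P" "h = hpoly N \<kappa> \<rho>"
      by blast
    \<comment> \<open>Pairing with the dual element \<open>msym_tilde N \<rho>\<close> extracts the
      scalar at \<open>h\<close>, up to the factor \<open>1 / 2 ^ n\<close>.\<close>
    have "0 = harmonic_pairing N \<kappa> n (\<Sum>\<mu>\<in>?P. u (hpoly N \<kappa> \<mu>) *\<^sub>R hpoly N \<kappa> \<mu>) (msym_tilde N \<rho>)"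
      using zero by (simp add: sum.reindex[OF inj] harmonic_pairing_zero_left)
    also have "\<dots> = (\<Sum>\<mu>\<in>?P. if \<mu> = \<rho> then u h / 2 ^ n else 0)"
      unfolding harmonic_pairing_sum_left using \<rho> dual by (intro sum.cong) auto
    finally show "u h = 0"
      using \<rho> fin by simp
  qed (simp add: fin)
  moreover have "span (hpoly N \<kappa> ` ?P) = harmonic_B N \<kappa> (2 * n)"
  proof
    show "span (hpoly N \<kappa> ` ?P) \<subseteq> harmonic_B N \<kappa> (2 * n)"
      unfolding n using hpoly_harmonic[OF assms(1,3)]
      by (intro span_minimal subspace_harmonic_B) blast
    show "harmonic_B N \<kappa> (2 * n) \<subseteq> span (hpoly N \<kappa> ` ?P)"
    proof
      fix f
      assume "f \<in> harmonic_B N \<kappa> (2 * n)"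
      then show "f \<in> span (hpoly N \<kappa> ` ?P)"
        unfolding n
        by (subst harmonic_B_eq_sum_hpoly[OF assms(1,3), of f m])
          (auto intro!: span_sum span_scale intro: span_base)
    qed
  qed
  ultimately show ?thesis
    using inj by blast
qed

end
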